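(* Let $\mathbb{F}$ be any field and let $(A,[\cdot,\cdot],\sigma)$ be a finite-dimensional multiplicative simple Hom-Lie algebra over $\mathbb{F}$. Then exactly one of the following holds. (1) $(A,[\cdot,\cdot],\sigma)$ is the Yau's twist of a direct sum $L=\bigoplus_{i=1}^n\mathfrak{s}_i$ of $n\ge1$ copies of a simple Lie algebra $\mathfrak{s}$ with respect to a Lie algebra automorphism $\sigma$ of $L$ that acts simply transitively on the $n$ components (i.e. permutes $\mathfrak{s}_1,\dots,\mathfrak{s}_n$ by a cyclic permutation of length $n$): $A=L$ as a vector space and $[\cdot,\cdot]=\sigma\circ[\cdot,\cdot]_L$. Such a structure is unique up to the conjugacy of $\sigma^n|_{\mathfrak{s}}$: if $(A,[\cdot,\cdot],\sigma)$ and $(B,[\cdot,\cdot]',\eta)$ are two Hom-Lie algebras obtained in this way from $\bigoplus_{i=1}^n\mathfrak{s}_i$ (with $\mathfrak{s}_i\simeq\mathfrak{s}$) and $\bigoplus_{j=1}^{n}\mathfrak{s}'_j$ (with $\mathfrak{s}'_j\simeq\mathfrak{s}'$), then they are isomorphic as Hom-Lie algebras if and only if there exist indices $i,j$ and an isomorphism of Lie algebras $\phi:\mathfrak{s}_i\to\mathfrak{s}'_j$ with $\sigma^n|_{\mathfrak{s}_i}=\phi^{-1}\circ\eta^n|_{\mathfrak{s}'_j}\circ\phi$. (2) $\sigma=0$ and $(A,[\cdot,\cdot])$ is a simple anticommutative algebra; such Hom-Lie algebras are determined up to isomorphism by the isomorphism class of the anticommutative algebra $(A,[\cdot,\cdo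t])$.
   Context: An anticommutative algebra is a vector space with a bilinear product $[\cdot,\cdot]$ satisfying $[x,x]=0$ for all $x$; it is simple if the product is nonzero and its only ideals are $0$ and itself. A Hom-Lie algebra is a triple $(A,[\cdot,\cdot],\sigma)$ with $(A,[\cdot,\cdot])$ an anticommutative algebra and $\sigma:A\to A$ linear (the twisting map) with $[\sigma(x),[y,z]]+[\sigma(y),[z,x]]+[\sigma(z),[x,y]]=0$ for all $x,y,z$. It is multiplicative if $\sigma([x,y])=[\sigma(x),\sigma(y)]$ for all $x,y$. A Hom-ideal is a subspace $I$ with $[I,A]\subset I$ and $\sigma(I)\subset I$; a Hom-Lie algebra is simple if it is not abelian (its product is nonzero) and its only Hom-ideals are $0$ and $A$. An isomorphism of Hom-Lie algebras $(A,[\cdot,\cdot]^A,\sigma_A)\to(B,[\cdot,\cdot]^B,\sigma_B)$ is a linear bijection $\varphi$ with $\varphi([u,v]^A)=[\varphi(u),\varphi(v)]^B$ and $\varphi\circ\sigma_A=\sigma_B\circ\varphi$. If $(L,[\cdot,\cdot]_L)$ is a Lie algebra and $\sigma$ is a Lie algebra automorphism of $L$, the Yau's twist of $L$ with respect to $\sigma$ is the Hom-Lie algebra $(L,\sigma\circ[\cdot,\cdot]_L,\sigma)$. *)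

theory Defs
  imports "HOL.Vector_Spaces" "HOL-Combinatorics.Cycles"
begin

text \<open>
  Algebras live on a linear subspace \<open>V\<close> of an ambient vector space, because the summands of a
  direct sum have to be algebras in their own right. The bracket is only constrained on \<open>V\<close>;
  an algebra whose underlying space is the whole ambient space has \<open>V = UNIV\<close>.
\<close>

locale anticommutative_algebra = vector_space scale
  for scale :: "'f::field \<Rightarrow> 'a::ab_group_add \<Rightarrow> 'a" +
  fixes V :: "'a set" and br :: "'a \<Rightarrow> 'a \<Rightarrow> 'a"
  assumes subspace_carrier: "subspace V"
    and br_closed: "\<lbrakk>x \<in> V; y \<in> V\<rbrakk> \<Longrightarrow> br x y \<in> V"
    and br_add_left: "\<lbrakk>x \<in> V; y \<in> V; z \<in> V\<rbrakk> \<Longrightarrow> br (x + y) z = br x z + br y z"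
    and br_add_right: "\<lbrakk>x \<in> V; y \<in> V; z \<in> V\<rbrakk> \<Longrightarrow> br x (y + z) = br x y + br x z"
    and br_scale_left: "\<lbrakk>x \<in> V; y \<in> V\<rbrakk> \<Longrightarrow> br (scale c x) y = scale c (br x y)"
    and br_scale_right: "\<lbrakk>x \<in> V; y \<in> V\<rbrakk> \<Longrightarrow> br x (scale c y) = scale c (br x y)"
    and br_self: "x \<in> V \<Longrightarrow> br x x = 0"
begin

definition ideal :: "'a set \<Rightarrow> bool" where
  "ideal I \<longleftrightarrow> subspace I \<and> I \<subseteq> V \<and> (\<forall>x\<in>I. \<forall>y\<in>V. br x y \<in> I)"

end

locale simple_anticommutative_algebra = anticommutative_algebra +
  assumes br_nonzero: "\<exists>x\<in>V. \<exists>y\<in>V. br x y \<noteq> 0"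
    and ideal_trivial: "ideal I \<Longrightarrow> I = {0} \<or> I = V"

locale lie_algebra = anticommutative_algebra +
  assumes jacobi:
    "\<lbrakk>x \<in> V; y \<in> V; z \<in> V\<rbrakk> \<Longrightarrow> br x (br y z) + br y (br z x) + br z (br x y) = 0"

locale simple_lie_algebra = lie_algebra + simple_anticommutative_algebra

locale hom_lie_algebra = anticommutative_algebra scale UNIV br
  for scale :: "'f::field \<Rightarrow> 'a::ab_group_add \<Rightarrow> 'a" and br :: "'a \<Rightarrow> 'a \<Rightarrow> 'a" +
  fixes \<sigma> :: "'a \<Rightarrow> 'a"
  assumes linear_twist: "Vector_Spaces.linear scale scale \<sigma>"
    and hom_jacobi: "br (\<sigma> x) (br y z) + br (\<sigma> y) (br z x) + br (\<sigma> z) (br x y) = 0"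
begin

definition hom_ideal :: "'a set \<Rightarrow> bool" where
  "hom_ideal I \<longleftrightarrow> subspace I \<and> (\<forall>x\<in>I. \<forall>y. br x y \<in> I) \<and> \<sigma> ` I \<subseteq> I"

end

locale multiplicative_hom_lie_algebra = hom_lie_algebra +
  assumes multiplicative: "\<sigma> (br x y) = br (\<sigma> x) (\<sigma> y)"

locale simple_hom_lie_algebra = hom_lie_algebra +
  assumes not_abelian: "\<exists>x y. br x y \<noteq> 0"
    and hom_ideal_trivial: "hom_ideal I \<Longrightarrow> I = {0} \<or> I = UNIV"

definition algebra_iso ::
  "('f::field \<Rightarrow> 'a::ab_group_add \<Rightarrow> 'a) \<Rightarrow> 'a set \<Rightarrow> ('a \<Rightarrow> 'a \<Rightarrow> 'a) \<Rightarrow>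
   ('f \<Rightarrow> 'b::ab_group_add \<Rightarrow> 'b) \<Rightarrow> 'b set \<Rightarrow> ('b \<Rightarrow> 'b \<Rightarrow> 'b) \<Rightarrow> ('a \<Rightarrow> 'b) \<Rightarrow> bool" where
  "algebra_iso scaleA V brA scaleB W brB \<phi> \<longleftrightarrow>
     bij_betw \<phi> V W \<and>
     (\<forall>x\<in>V. \<forall>y\<in>V. \<phi> (x + y) = \<phi> x + \<phi> y) \<and>
     (\<forall>c. \<forall>x\<in>V. \<phi> (scaleA c x) = scaleB c (\<phi> x)) \<and>
     (\<forall>x\<in>V. \<forall>y\<in>V. \<phi> (brA x y) = brB (\<phi> x) (\<phi> y))"

definition hom_lie_iso ::
  "('f::field \<Rightarrow> 'a::ab_group_add \<Rightarrow> 'a) \<Rightarrow> ('a \<Rightarrow> 'a \<Rightarrow> 'a) \<Rightarrow> ('a \<Rightarrow> 'a) \<Rightarrow>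
   ('f \<Rightarrow> 'b::ab_group_add \<Rightarrow> 'b) \<Rightarrow> ('b \<Rightarrow> 'b \<Rightarrow> 'b) \<Rightarrow> ('b \<Rightarrow> 'b) \<Rightarrow> ('a \<Rightarrow> 'b) \<Rightarrow> bool" where
  "hom_lie_iso scaleA brA \<sigma> scaleB brB \<eta> \<phi> \<longleftrightarrow>
     algebra_iso scaleA UNIV brA scaleB UNIV brB \<phi> \<and> \<phi> \<circ> \<sigma> = \<eta> \<circ> \<phi>"

definition yau_twist :: "('a \<Rightarrow> 'a \<Rightarrow> 'a) \<Rightarrow> ('a \<Rightarrow> 'a) \<Rightarrow> 'a \<Rightarrow> 'a \<Rightarrow> 'a" where
  "yau_twist lbr \<sigma> = (\<lambda>x y. \<sigma> (lbr x y))"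

lemma hom_lie_algebra_yau_twist:
  assumes L: "lie_algebra scale UNIV lbr"
    and aut: "algebra_iso scale UNIV lbr scale UNIV lbr \<sigma>"
  shows "multiplicative_hom_lie_algebra scale (yau_twist lbr \<sigma>) \<sigma>"
proof -
  interpret L: lie_algebra scale UNIV lbr by (fact L)
  have add: "\<sigma> (x + y) = \<sigma> x + \<sigma> y" and scl: "\<sigma> (scale c x) = scale c (\<sigma> x)"
    and mul: "\<sigma> (lbr x y) = lbr (\<sigma> x) (\<sigma> y)" for c x y
    using aut by (simp_all add: algebra_iso_def)
  have zero: "\<sigma> 0 = 0"
    using add[of 0 0] by simp
  have lin: "Vector_Spaces.linear scale scale \<sigma>"
    using add scl L.vector_space_axioms
    by (simp add: Vector_Spaces.linear_def module_hom_def module_hom_axioms_def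
        L.module_axioms)
  have jac: "\<sigma> (lbr (\<sigma> x) (\<sigma> (lbr y z))) + \<sigma> (lbr (\<sigma> y) (\<sigma> (lbr z x)))
      + \<sigma> (lbr (\<sigma> z) (\<sigma> (lbr x y))) = 0" for x y z
    using arg_cong[OF L.jacobi[of x y z], of "\<lambda>u. \<sigma> (\<sigma> u)"]
    by (simp add: add mul zero)
  show ?thesis
    by unfold_locales
      (simp_all add: yau_twist_def L.br_add_left L.br_add_right L.br_scale_left L.br_scale_right
        L.br_self add scl mul zero lin[unfolded Vector_Spaces.linear_def] jac[unfolded mul])
qed

text \<open>
  \<open>(UNIV, lbr)\<close> is the (internal) direct sum of its Lie subalgebras \<open>S 1, \<dots>, S n\<close>, each of which
  is isomorphic to the Lie algebra \<open>(T, tbr)\<close>. That \<open>T\<close> lies in the same ambient space is no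
  restriction: any Lie algebra isomorphic to the summands can be transported to \<open>S 1\<close>.
\<close>

definition direct_sum_of_copies ::
  "('f::field \<Rightarrow> 'a::ab_group_add \<Rightarrow> 'a) \<Rightarrow> ('a \<Rightarrow> 'a \<Rightarrow> 'a) \<Rightarrow> nat \<Rightarrow> (nat \<Rightarrow> 'a set) \<Rightarrow>
   'a set \<Rightarrow> ('a \<Rightarrow> 'a \<Rightarrow> 'a) \<Rightarrow> bool" where
  "direct_sum_of_copies scale lbr n S T tbr \<longleftrightarrow>
     lie_algebra scale UNIV lbr \<and>
     (\<forall>i\<in>{1..n}. lie_algebra scale (S i) lbr) \<and>
     (\<forall>x. \<exists>!f. f \<in> PiE {1..n} S \<and> x = (\<Sum>i=1..n. f i)) \<and>
     (\<forall>i\<in>{1..n}. \<forall>j\<in>{1..n}. i \<noteq> j \<longrightarrow> (\<forall>x\<in>S i. \<forall>y\<in>S j. lbr x y = 0)) \<and>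
     (\<forall>i\<in>{1..n}. \<exists>\<psi>. algebra_iso scale (S i) lbr scale T tbr \<psi>)"

definition permutes_summands_cyclically ::
  "nat \<Rightarrow> (nat \<Rightarrow> 'a set) \<Rightarrow> ('a \<Rightarrow> 'a) \<Rightarrow> bool" where
  "permutes_summands_cyclically n S \<sigma> \<longleftrightarrow>
     (\<exists>cs. cycle cs \<and> set cs = {1..n} \<and> (\<forall>i\<in>{1..n}. \<sigma> ` S i = S (cycle_of_list cs i)))"

definition cyclic_yau_twist ::
  "('f::field \<Rightarrow> 'a::ab_group_add \<Rightarrow> 'a) \<Rightarrow> ('a \<Rightarrow> 'a \<Rightarrow> 'a) \<Rightarrow> ('a \<Rightarrow> 'a) \<Rightarrow> nat \<Rightarrow>
   ('a \<Rightarrow> 'a \<Rightarrow> 'a) \<Rightarrow> (nat \<Rightarrow> 'a set) \<Rightarrow> 'a set \<Rightarrow> ('a \<Rightarrow> 'a \<Rightarrow> 'a) \<Rightarrow> bool" where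
  "cyclic_yau_twist scale br \<sigma> n lbr S T tbr \<longleftrightarrow>
     n \<ge> 1 \<and>
     simple_lie_algebra scale T tbr \<and>
     direct_sum_of_copies scale lbr n S T tbr \<and>
     algebra_iso scale UNIV lbr scale UNIV lbr \<sigma> \<and>
     permutes_summands_cyclically n S \<sigma> \<and>
     br = yau_twist lbr \<sigma>"

end

theory Submission
  imports Defs
begin

text \<open>
  The kernel of the twist \<open>\<sigma>\<close> is a Hom-ideal, so \<open>\<sigma> = 0\<close> or \<open>\<sigma>\<close> is bijective. In the second case
  \<open>\<sigma>\<^sup>-\<^sup>1 \<circ> [\<cdot>,\<cdot>]\<close> is a Lie bracket having \<open>\<sigma>\<close> as an automorphism and no nonzero proper \<open>\<sigma>\<close>-invariant ideal;
  in particular its centre vanishes. For a minimal ideal \<open>I\<close>, distinct ideals among the \<open>\<sigma>\<^sup>k(I)\<close>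
  commute. By finite dimension the partial sums \<open>I + \<sigma>(I) + \<dots> + \<sigma>\<^sup>m\<^sup>-\<^sup>1(I)\<close> become \<open>\<sigma>\<close>-invariant, hence
  everything; for the least such \<open>m = n\<close> the ideal \<open>\<sigma>\<^sup>n(I)\<close> must be one of the earlier ones, since
  otherwise it would be central, and minimality of \<open>n\<close> forces \<open>\<sigma>\<^sup>n(I) = I\<close>. The sum is direct because
  bracketing a relation with one summand isolates an element of the centre of that summand.
  An isomorphism of twists is one of the Lie algebras, so it maps minimal ideals, which are exactly the
  summands, to minimal ideals.
\<close>

section \<open>Isomorphisms, ideals and minimal ideals\<close>

lemma algebra_isoD:
  assumes "algebra_iso scaleA V brA scaleB W brB \<phi>"
  shows "bij_betw \<phi> V W"
    and "\<lbrakk>x \<in> V; y \<in> V\<rbrakk> \<Longrightarrow> \<phi> (x + y) = \<phi> x + \<phi> y"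
    and "x \<in> V \<Longrightarrow> \<phi> (scaleA c x) = scaleB c (\<phi> x)"
    and "\<lbrakk>x \<in> V; y \<in> V\<rbrakk> \<Longrightarrow> \<phi> (brA x y) = brB (\<phi> x) (\<phi> y)"
    and "inj_on \<phi> V" and "\<phi> ` V = W" and "x \<in> V \<Longrightarrow> \<phi> x \<in> W"
  using assms by (auto simp: algebra_iso_def bij_betw_def)

lemma algebra_iso_comp:
  assumes "algebra_iso scaleA V brA scaleB W brB \<phi>" and "algebra_iso scaleB W brB scaleC X brC \<psi>"
  shows "algebra_iso scaleA V brA scaleC X brC (\<psi> \<circ> \<phi>)"
  using bij_betw_trans[OF algebra_isoD(1)[OF assms(1)] algebra_isoD(1)[OF assms(2)]]
    algebra_isoD[OF assms(1)] algebra_isoD[OF assms(2)]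
  unfolding algebra_iso_def by simp

lemma algebra_iso_funpow:
  assumes "algebra_iso scale V br scale V br \<sigma>"
  shows "algebra_iso scale V br scale V br (\<sigma> ^^ k)"
proof (induction k)
  case 0
  show ?case by (simp add: algebra_iso_def bij_betw_def)
next
  case (Suc k)
  show ?case using algebra_iso_comp[OF Suc assms] by (simp add: comp_def)
qed

lemma algebra_iso_restrict:
  assumes "algebra_iso scaleA V brA scaleB W brB \<phi>" and "I \<subseteq> V"
  shows "algebra_iso scaleA I brA scaleB (\<phi> ` I) brB \<phi>"
  using assms unfolding algebra_iso_def bij_betw_def by (auto intro: inj_on_subset simp: subset_iff)

section \<open>Brackets, ideals, centre and minimal ideals\<close>

context anticommutative_algebra
begin

lemma zero_carrier: "0 \<in> V"
  and add_carrier: "\<lbrakk>x \<in> V; y \<in> V\<rbrakk> \<Longrightarrow> x + y \<in> V"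
  and scale_carrier: "x \<in> V \<Longrightarrow> scale c x \<in> V"
  and diff_carrier: "\<lbrakk>x \<in> V; y \<in> V\<rbrakk> \<Longrightarrow> x - y \<in> V"
  using subspace_carrier by (auto intro: subspace_0 subspace_add subspace_scale subspace_diff)

lemma br_zero_left: "x \<in> V \<Longrightarrow> br 0 x = 0"
  using br_scale_left[of x x 0] zero_carrier br_scale_left[of 0 x 0] by simp

lemma br_zero_right: "x \<in> V \<Longrightarrow> br x 0 = 0"
  using br_scale_right[of x 0 0] zero_carrier by simp

lemma br_anticommute:
  assumes "x \<in> V" "y \<in> V"
  shows "br x y = - br y x"
proof -
  have "br (x + y) (x + y) = br x y + br y x"
    using assms br_self[of x] br_self[of y]
    by (simp add: br_add_left[of x y] br_add_right[of _ x y] add_carrier)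
  moreover have "br (x + y) (x + y) = 0"
    using assms by (intro br_self add_carrier)
  ultimately show ?thesis
    by (simp add: eq_neg_iff_add_eq_0)
qed

lemma br_diff_left: "\<lbrakk>x \<in> V; y \<in> V; z \<in> V\<rbrakk> \<Longrightarrow> br (x - y) z = br x z - br y z"
  using br_add_left[of "x - y" y z] by (simp add: diff_carrier algebra_simps)

lemma br_sum_left:
  assumes "\<And>k. k \<in> K \<Longrightarrow> g k \<in> V" and y: "y \<in> V"
  shows "br (sum g K) y = (\<Sum>k\<in>K. br (g k) y)"
  using assms(1)
proof (induction K rule: infinite_finite_induct)
  case (insert k K)
  then have "sum g K \<in> V" using subspace_sum[OF subspace_carrier] by blast
  with insert y show ?case by (simp add: br_add_left)
qed (use y in \<open>simp_all add: br_zero_left\<close>)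

lemma br_sum_right:
  assumes "\<And>k. k \<in> K \<Longrightarrow> g k \<in> V" and y: "y \<in> V"
  shows "br y (sum g K) = (\<Sum>k\<in>K. br y (g k))"
  using assms(1)
proof (induction K rule: infinite_finite_induct)
  case (insert k K)
  then have "sum g K \<in> V" using subspace_sum[OF subspace_carrier] by blast
  with insert y show ?case by (simp add: br_add_right)
qed (use y in \<open>simp_all add: br_zero_right\<close>)

lemma ideal_subspace: "ideal I \<Longrightarrow> subspace I"
  and ideal_carrier: "\<lbrakk>ideal I; x \<in> I\<rbrakk> \<Longrightarrow> x \<in> V"
  and ideal_br_left: "\<lbrakk>ideal I; x \<in> I; y \<in> V\<rbrakk> \<Longrightarrow> br x y \<in> I"
  by (auto simp: ideal_def)

lemma ideal_br_right: "\<lbrakk>ideal I; x \<in> V; y \<in> I\<rbrakk> \<Longrightarrow> br x y \<in> I"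
  using br_anticommute[of x y] subspace_neg[of I "br y x"] by (auto simp: ideal_def)

lemma ideal_Int: "\<lbrakk>ideal I; ideal J\<rbrakk> \<Longrightarrow> ideal (I \<inter> J)"
  by (auto simp: ideal_def intro: subspace_inter)

lemma ideal_carrier_whole: "ideal V"
  by (auto simp: ideal_def subspace_carrier br_closed)

definition centre :: "'a set" where
  "centre = {x \<in> V. \<forall>y\<in>V. br x y = 0}"

lemma ideal_centre: "ideal centre"
  unfolding ideal_def
proof (intro conjI ballI subspaceI)
  show "centre \<subseteq> V" by (auto simp: centre_def)
qed (auto simp: centre_def br_closed br_zero_left br_add_left br_scale_left zero_carrier
    add_carrier scale_carrier)

definition minimal_ideal :: "'a set \<Rightarrow> bool" where
  "minimal_ideal I \<longleftrightarrow> ideal I \<and> I \<noteq> {0} \<and> (\<forall>K. ideal K \<and> K \<subseteq> I \<and> K \<noteq> {0} \<longrightarrow> K = I)"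

text \<open>The bracket lies in \<open>I \<inter> J\<close>, an ideal inside both. Were this
  intersection nonzero, minimality would make it equal to both \<open>I\<close> and
  \<open>J\<close>.\<close>

lemma minimal_ideals_commute:
  assumes "minimal_ideal I" "minimal_ideal J" "I \<noteq> J" "x \<in> I" "y \<in> J"
  shows "br x y = 0"
proof -
  have I: "ideal I" and J: "ideal J"
    using assms by (auto simp: minimal_ideal_def)
  have "I \<inter> J = {0}"
    using assms(1-3) ideal_Int[OF I J] unfolding minimal_ideal_def
    by (metis inf_le1 inf_le2)
  moreover have "br x y \<in> I \<inter> J"
    using ideal_br_left[OF I, of x y] ideal_br_right[OF J, of x y] assms(4,5)
      ideal_carrier[OF I] ideal_carrier[OF J] by auto
  ultimately show ?thesis by auto
qed

end

lemma (in simple_anticommutative_algebra) centre_zero: "centre = {0}"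
  using ideal_trivial[OF ideal_centre] br_nonzero by (auto simp: centre_def)

lemma (in lie_algebra) lie_subalgebra:
  assumes "subspace W" "W \<subseteq> V" "\<And>x y. \<lbrakk>x \<in> W; y \<in> W\<rbrakk> \<Longrightarrow> br x y \<in> W"
  shows "lie_algebra scale W br"
  using assms
  by unfold_locales
    (auto simp: subset_iff br_add_left br_add_right br_scale_left br_scale_right br_self jacobi)

text \<open>Carriers are arbitrary so that the same facts serve powers of an automorphism of the
  whole algebra and isomorphisms between single summands. The inverse is again an instance, so
  properties need only be pushed forward along \<open>\<phi>\<close>.\<close>

locale algebra_isomorphism =
  A: anticommutative_algebra scaleA V brA + B: anticommutative_algebra scaleB W brB
  for scaleA :: "'f::field \<Rightarrow> 'a::ab_group_add \<Rightarrow> 'a" and V brA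
    and scaleB :: "'f \<Rightarrow> 'b::ab_group_add \<Rightarrow> 'b" and W brB +
  fixes \<phi>
  assumes iso: "algebra_iso scaleA V brA scaleB W brB \<phi>"
begin

lemmas iso_bij = algebra_isoD(1)[OF iso]
  and iso_add = algebra_isoD(2)[OF iso]
  and iso_scale = algebra_isoD(3)[OF iso]
  and iso_br = algebra_isoD(4)[OF iso]
  and iso_inj = algebra_isoD(5)[OF iso]
  and iso_image = algebra_isoD(6)[OF iso]
  and iso_closed = algebra_isoD(7)[OF iso]

lemma iso_zero: "\<phi> 0 = 0"
  using iso_add[of 0 0] A.zero_carrier by simp

lemma iso_eq_zero: "x \<in> V \<Longrightarrow> \<phi> x = 0 \<longleftrightarrow> x = 0"
  using iso_inj iso_zero A.zero_carrier by (metis inj_onD)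

lemma iso_sum: "(\<And>k. k \<in> K \<Longrightarrow> g k \<in> V) \<Longrightarrow> \<phi> (sum g K) = (\<Sum>k\<in>K. \<phi> (g k))"
proof (induction K rule: infinite_finite_induct)
  case (insert k K)
  then have "sum g K \<in> V" using A.subspace_sum[OF A.subspace_carrier] by blast
  with insert show ?case by (simp add: iso_add)
qed (simp_all add: iso_zero)

lemma algebra_iso_inv: "algebra_iso scaleB W brB scaleA V brA (inv_into V \<phi>)"
proof -
  let ?\<psi> = "inv_into V \<phi>"
  have right: "\<phi> (?\<psi> w) = w" and mem: "?\<psi> w \<in> V" if "w \<in> W" for w
    using that iso_image by (auto intro: f_inv_into_f inv_into_into)
  have left: "?\<psi> (\<phi> v) = v" if "v \<in> V" for v
    using that iso_inj by simp
  have "?\<psi> (x + y) = ?\<psi> x + ?\<psi> y" if "x \<in> W" "y \<in> W" for x y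
    using left[of "?\<psi> x + ?\<psi> y"] that by (simp add: iso_add mem right A.add_carrier)
  moreover have "?\<psi> (scaleB c x) = scaleA c (?\<psi> x)" if "x \<in> W" for c x
    using left[of "scaleA c (?\<psi> x)"] that by (simp add: iso_scale mem right A.scale_carrier)
  moreover have "?\<psi> (brB x y) = brA (?\<psi> x) (?\<psi> y)" if "x \<in> W" "y \<in> W" for x y
    using left[of "brA (?\<psi> x) (?\<psi> y)"] that by (simp add: iso_br mem right A.br_closed)
  ultimately show ?thesis
    unfolding algebra_iso_def using bij_betw_inv_into[OF iso_bij] by blast
qed

lemma subspace_image:
  assumes "A.subspace I" "I \<subseteq> V"
  shows "B.subspace (\<phi> ` I)"
proof (rule B.subspaceI)
  show "0 \<in> \<phi> ` I" using iso_zero A.subspace_0[OF assms(1)] by (metis imageI)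
next
  fix x y assume "x \<in> \<phi> ` I" "y \<in> \<phi> ` I"
  then obtain u v where "u \<in> I" "v \<in> I" "x = \<phi> u" "y = \<phi> v" by blast
  then have "x + y = \<phi> (u + v)" "u + v \<in> I"
    using assms iso_add A.subspace_add by (auto simp: subset_iff)
  then show "x + y \<in> \<phi> ` I" by blast
next
  fix c x assume "x \<in> \<phi> ` I"
  then obtain u where "u \<in> I" "x = \<phi> u" by blast
  then have "scaleB c x = \<phi> (scaleA c u)" "scaleA c u \<in> I"
    using assms iso_scale A.subspace_scale by (auto simp: subset_iff)
  then show "scaleB c x \<in> \<phi> ` I" by blast
qed

lemma ideal_image:
  assumes "A.ideal I"
  shows "B.ideal (\<phi> ` I)"
  unfolding B.ideal_def
proof (intro conjI ballI)
  show "B.subspace (\<phi> ` I)"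
    using subspace_image assms by (auto simp: A.ideal_def)
  show "\<phi> ` I \<subseteq> W"
    using assms iso_closed by (auto simp: A.ideal_def)
  fix x y assume "x \<in> \<phi> ` I" "y \<in> W"
  then obtain u v where "u \<in> I" "v \<in> V" "x = \<phi> u" "y = \<phi> v"
    using iso_image by blast
  then have "brB x y = \<phi> (brA u v)" "brA u v \<in> I"
    using assms by (auto simp: A.ideal_def iso_br)
  then show "brB x y \<in> \<phi> ` I" by blast
qed

lemma algebra_isomorphism_inv: "algebra_isomorphism scaleB W brB scaleA V brA (inv_into V \<phi>)"
  by unfold_locales (fact algebra_iso_inv)

lemma image_inv_image: "K \<subseteq> W \<Longrightarrow> \<phi> ` inv_into V \<phi> ` K = K"
  using iso_image by (simp add: image_inv_into_cancel)

lemma inv_image_image: "K \<subseteq> V \<Longrightarrow> inv_into V \<phi> ` \<phi> ` K = K"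
  using iso_inj by (simp add: inv_into_image_cancel)

lemma image_eq_zero:
  assumes "I \<subseteq> V"
  shows "\<phi> ` I = {0} \<longleftrightarrow> I = {0}"
proof -
  interpret inv: algebra_isomorphism scaleB W brB scaleA V brA "inv_into V \<phi>"
    by (fact algebra_isomorphism_inv)
  show ?thesis using inv_image_image[OF assms] iso_zero inv.iso_zero by force
qed

text \<open>An ideal inside the image pulls back along the inverse to an ideal inside
  \<open>I\<close>, where minimality applies.\<close>

lemma minimal_ideal_image:
  assumes "A.minimal_ideal I"
  shows "B.minimal_ideal (\<phi> ` I)"
  unfolding B.minimal_ideal_def
proof (intro conjI allI impI)
  interpret inv: algebra_isomorphism scaleB W brB scaleA V brA "inv_into V \<phi>"
    by (fact algebra_isomorphism_inv)
  have I: "A.ideal I" "I \<noteq> {0}" "I \<subseteq> V"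
    and min: "\<And>K. \<lbrakk>A.ideal K; K \<subseteq> I; K \<noteq> {0}\<rbrakk> \<Longrightarrow> K = I"
    using assms by (auto simp: A.minimal_ideal_def A.ideal_def)
  show "B.ideal (\<phi> ` I)" by (rule ideal_image[OF I(1)])
  show "\<phi> ` I \<noteq> {0}" using image_eq_zero I by simp
  fix K assume K: "B.ideal K \<and> K \<subseteq> \<phi> ` I \<and> K \<noteq> {0}"
  then have KW: "K \<subseteq> W" by (simp add: B.ideal_def)
  have "inv_into V \<phi> ` K = I"
  proof (rule min)
    show "A.ideal (inv_into V \<phi> ` K)" using inv.ideal_image K by blast
    show "inv_into V \<phi> ` K \<subseteq> I" using K inv_image_image[OF I(3)] by blast
    show "inv_into V \<phi> ` K \<noteq> {0}" using inv.image_eq_zero[OF KW] K by simp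
  qed
  then show "K = \<phi> ` I" using image_inv_image[OF KW] by simp
qed

lemma simple_transfer:
  assumes "simple_anticommutative_algebra scaleA V brA"
  shows "simple_anticommutative_algebra scaleB W brB"
proof -
  interpret S: simple_anticommutative_algebra scaleA V brA by fact
  interpret inv: algebra_isomorphism scaleB W brB scaleA V brA "inv_into V \<phi>"
    by (fact algebra_isomorphism_inv)
  show ?thesis
  proof unfold_locales
    obtain x y where xy: "x \<in> V" "y \<in> V" "brA x y \<noteq> 0" using S.br_nonzero by blast
    then have "brB (\<phi> x) (\<phi> y) \<noteq> 0"
      using iso_eq_zero[of "brA x y"] by (simp add: iso_br A.br_closed)
    then show "\<exists>x\<in>W. \<exists>y\<in>W. brB x y \<noteq> 0" using xy iso_closed by blast
  next
    fix K assume K: "B.ideal K"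
    then have KW: "K \<subseteq> W" by (simp add: B.ideal_def)
    have "inv_into V \<phi> ` K = {0} \<or> inv_into V \<phi> ` K = V"
      using S.ideal_trivial inv.ideal_image[OF K] by simp
    then show "K = {0} \<or> K = W"
      using inv.image_eq_zero[OF KW] image_inv_image[OF KW] iso_image by auto
  qed
qed

end

section \<open>Lie algebras with an automorphism\<close>

locale lie_automorphism = lie_algebra scale UNIV br
  for scale :: "'f::field \<Rightarrow> 'a::ab_group_add \<Rightarrow> 'a" and br +
  fixes \<sigma> :: "'a \<Rightarrow> 'a"
  assumes automorphism: "algebra_iso scale UNIV br scale UNIV br \<sigma>"
begin

lemma power_isomorphism: "algebra_isomorphism scale UNIV br scale UNIV br (\<sigma> ^^ k)"
  by (intro algebra_isomorphism.intro algebra_isomorphism_axioms.intro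
      anticommutative_algebra_axioms algebra_iso_funpow automorphism)

lemmas power_add = algebra_isomorphism.iso_add[OF power_isomorphism UNIV_I UNIV_I]
  and power_scale = algebra_isomorphism.iso_scale[OF power_isomorphism UNIV_I]
  and power_br = algebra_isomorphism.iso_br[OF power_isomorphism UNIV_I UNIV_I]
  and power_inj = algebra_isomorphism.iso_inj[OF power_isomorphism]
  and power_zero = algebra_isomorphism.iso_zero[OF power_isomorphism]
  and power_eq_zero = algebra_isomorphism.iso_eq_zero[OF power_isomorphism UNIV_I]
  and power_sum = algebra_isomorphism.iso_sum[OF power_isomorphism UNIV_I]
  and power_ideal = algebra_isomorphism.ideal_image[OF power_isomorphism]
  and power_minimal_ideal = algebra_isomorphism.minimal_ideal_image[OF power_isomorphism]

lemma automorphism_sum: "\<sigma> (sum g K) = (\<Sum>k\<in>K. \<sigma> (g k))"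
  using power_sum[where k = 1] by simp

lemma automorphism_br: "\<sigma> (br x y) = br (\<sigma> x) (\<sigma> y)"
  using power_br[where k = 1] by simp

lemma automorphism_inj: "inj \<sigma>"
  using power_inj[where k = 1] by simp

lemma automorphism_surj: "surj \<sigma>"
  using algebra_isoD(6)[OF automorphism] .

lemma automorphism_zero: "\<sigma> 0 = 0"
  using power_zero[where k = 1] by simp

end

text \<open>The summands are encoded by one component \<open>I\<close> and its images under
  \<open>\<sigma> ^^ k\<close> for \<open>k < n\<close>, counted from 0. Directness of their sum is
  derived in \<open>components_unique\<close>. Coordinates \<open>g k\<close> lie in
  \<open>I\<close> for every \<open>k\<close>, also beyond \<open>n\<close>, which spares side
  conditions.\<close>

locale cyclic_lie_automorphism = lie_automorphism scale br \<sigma>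
  for scale :: "'f::field \<Rightarrow> 'a::ab_group_add \<Rightarrow> 'a" and br \<sigma> +
  fixes n :: nat and I :: "'a set"
  assumes n_pos: "n \<ge> 1"
    and component_simple: "simple_lie_algebra scale I br"
    and power_image: "(\<sigma> ^^ n) ` I = I"
    and components_commute:
      "\<lbrakk>i < n; j < n; i \<noteq> j; x \<in> I; y \<in> I\<rbrakk> \<Longrightarrow> br ((\<sigma> ^^ i) x) ((\<sigma> ^^ j) y) = 0"
    and components_span: "\<exists>g. (\<forall>k. g k \<in> I) \<and> x = (\<Sum>k<n. (\<sigma> ^^ k) (g k))"
begin

interpretation I: simple_lie_algebra scale I br
  by (fact component_simple)

text \<open>Distinct components commute, so only the \<open>j\<close>-th term survives, and
  \<open>\<sigma> ^^ j\<close> pulls out of it.\<close>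

lemma br_component:
  assumes "\<And>k. g k \<in> I" "j < n" "y \<in> I"
  shows "br (\<Sum>k<n. (\<sigma> ^^ k) (g k)) ((\<sigma> ^^ j) y) = (\<sigma> ^^ j) (br (g j) y)"
proof -
  have "br (\<Sum>k<n. (\<sigma> ^^ k) (g k)) ((\<sigma> ^^ j) y)
      = (\<Sum>k<n. br ((\<sigma> ^^ k) (g k)) ((\<sigma> ^^ j) y))"
    by (simp add: br_sum_left)
  also have "\<dots> = (\<Sum>k<n. if k = j then (\<sigma> ^^ j) (br (g j) y) else 0)"
    using assms by (intro sum.cong) (auto simp: components_commute power_br)
  finally show ?thesis using assms(2) by simp
qed

lemma br_components:
  assumes "\<And>k. g k \<in> I" "\<And>k. h k \<in> I"
  shows "br (\<Sum>k<n. (\<sigma> ^^ k) (g k)) (\<Sum>k<n. (\<sigma> ^^ k) (h k)) = (\<Sum>k<n. (\<sigma> ^^ k) (br (g k) (h k)))"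
  using assms by (simp add: br_sum_right br_component)

text \<open>Bracketing both sums with the \<open>j\<close>-th component and cancelling the injective
  \<open>\<sigma> ^^ j\<close> shows that \<open>g j - h j\<close> is central in \<open>I\<close>,
  which is simple and so has zero centre.\<close>

lemma components_unique:
  assumes "\<And>k. g k \<in> I" "\<And>k. h k \<in> I"
    and eq: "(\<Sum>k<n. (\<sigma> ^^ k) (g k)) = (\<Sum>k<n. (\<sigma> ^^ k) (h k))" and j: "j < n"
  shows "g j = h j"
proof -
  have "br (g j - h j) y = 0" if "y \<in> I" for y
    using br_component[of g j y] br_component[of h j y] assms that power_inj[of j]
    by (simp add: br_diff_left inj_eq)
  then have "g j - h j \<in> I.centre"
    unfolding I.centre_def using assms by (simp add: I.diff_carrier)
  then show ?thesis by (simp add: I.centre_zero)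
qed

lemma central_zero:
  assumes "\<And>y. br x y = 0"
  shows "x = 0"
proof -
  obtain g where g: "\<And>k. g k \<in> I" "x = (\<Sum>k<n. (\<sigma> ^^ k) (g k))"
    using components_span by blast
  have "g j = 0" if "j < n" for j
  proof -
    have "br (g j) y = 0" if "y \<in> I" for y
      using br_component[of g j y] g assms \<open>j < n\<close> that by (simp add: power_eq_zero)
    then have "g j \<in> I.centre" unfolding I.centre_def using g by simp
    then show ?thesis by (simp add: I.centre_zero)
  qed
  then show ?thesis using g by (simp add: power_zero)
qed

text \<open>Only coordinate 0 of \<open>y\<close> contributes to the bracket. This is what makes
  \<open>I\<close> an ideal of the whole algebra.\<close>

lemma br_component_ideal:
  assumes "x \<in> I"
  shows "\<exists>z\<in>I. br x y = br x z"
proof -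
  obtain g where g: "\<And>k. g k \<in> I" "y = (\<Sum>k<n. (\<sigma> ^^ k) (g k))"
    using components_span by blast
  have "br x y = - br y x" by (simp add: br_anticommute[of x y])
  also have "br y x = br (g 0) x"
    using br_component[of g 0 x] g assms n_pos by simp
  finally have "br x y = br x (g 0)"
    using br_anticommute[of x "g 0"] by simp
  then show ?thesis using g by blast
qed

lemma component_minimal: "minimal_ideal I"
  unfolding minimal_ideal_def
proof (intro conjI allI impI)
  show "ideal I"
    unfolding ideal_def using br_component_ideal I.br_closed I.subspace_carrier
    by (metis UNIV_I subsetI)
  show "I \<noteq> {0}" using I.br_nonzero by (auto simp: I.br_self)
  fix K assume K: "ideal K \<and> K \<subseteq> I \<and> K \<noteq> {0}"
  then have "I.ideal K" by (auto simp: ideal_def I.ideal_def)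
  then show "K = I" using I.ideal_trivial K by blast
qed

text \<open>A minimal ideal other than all these images would commute with each of them, hence with
  everything, and so vanish by \<open>central_zero\<close>. The components are thus recognisable
  from the Lie bracket alone.\<close>

lemma minimal_ideal_cases:
  assumes J: "minimal_ideal J"
  obtains k where "k < n" "J = (\<sigma> ^^ k) ` I"
proof -
  have "\<exists>k<n. J = (\<sigma> ^^ k) ` I"
  proof (rule ccontr)
    assume no: "\<not> ?thesis"
    have "x = 0" if x: "x \<in> J" for x
    proof (rule central_zero)
      fix y
      obtain g where g: "\<And>k. g k \<in> I" "y = (\<Sum>k<n. (\<sigma> ^^ k) (g k))"
        using components_span by blast
      have "br x ((\<sigma> ^^ k) (g k)) = 0" if "k < n" for k
        using minimal_ideals_commute[OF J power_minimal_ideal[OF component_minimal, of k]]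
          no that x g by blast
      then show "br x y = 0" using g by (simp add: br_sum_right)
    qed
    moreover have "0 \<in> J" "J \<noteq> {0}"
      using J subspace_0 by (auto simp: minimal_ideal_def ideal_def)
    ultimately show False by auto
  qed
  then show ?thesis using that by blast
qed

text \<open>Coordinates move up one place; the last one wraps around to position 0, picking up
  \<open>\<sigma> ^^ n\<close>.\<close>

lemma automorphism_components:
  assumes "\<And>k. g k \<in> I"
  shows "\<sigma> (\<Sum>k<n. (\<sigma> ^^ k) (g k))
    = (\<Sum>k<n. (\<sigma> ^^ k) (case k of 0 \<Rightarrow> (\<sigma> ^^ n) (g (n - 1)) | Suc m \<Rightarrow> g m))"
proof -
  obtain m where n: "n = Suc m" using n_pos by (cases n) auto
  have "\<sigma> (\<Sum>k<n. (\<sigma> ^^ k) (g k)) = (\<Sum>k<m. (\<sigma> ^^ Suc k) (g k)) + (\<sigma> ^^ n) (g m)"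
    unfolding n automorphism_sum by simp
  then show ?thesis
    by (simp add: n sum.lessThan_Suc_shift add.commute del: sum.lessThan_Suc)
qed

end

section \<open>Cyclic decomposition\<close>

text \<open>The sum of the ideals is written as an image of choice functions, so that closure is
  checked termwise on a witness.\<close>

lemma (in anticommutative_algebra) ideal_sum_image:
  assumes J: "\<And>k. k < m \<Longrightarrow> ideal (J k)"
  shows "ideal ((\<lambda>g. \<Sum>k<m. g k) ` {g. \<forall>k<m. g k \<in> J k})" (is "ideal ((\<lambda>g. ?s g) ` ?G)")
  unfolding ideal_def
proof (intro conjI ballI subspaceI subsetI)
  have V: "g k \<in> V" if "g \<in> ?G" "k < m" for g k
    using that J by (auto simp: ideal_def)
  show "0 \<in> ?s ` ?G"
    using J subspace_0 ideal_subspace by (intro image_eqI[where x = "\<lambda>_. 0"]) auto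
  show "x + y \<in> ?s ` ?G" if xy: "x \<in> ?s ` ?G" "y \<in> ?s ` ?G" for x y
  proof -
    obtain g h where "g \<in> ?G" "h \<in> ?G" "x = ?s g" "y = ?s h" using xy by blast
    then show ?thesis
      using J by (intro image_eqI[where x = "\<lambda>k. g k + h k"])
        (auto simp: sum.distrib ideal_def intro!: subspace_add)
  qed
  show "scale c x \<in> ?s ` ?G" if x: "x \<in> ?s ` ?G" for c x
  proof -
    obtain g where "g \<in> ?G" "x = ?s g" using x by blast
    then show ?thesis
      using J by (intro image_eqI[where x = "\<lambda>k. scale c (g k)"])
        (auto simp: scale_sum_right ideal_def intro!: subspace_scale)
  qed
  show "x \<in> V" if x: "x \<in> ?s ` ?G" for x
    using x V by (auto intro!: subspace_sum[OF subspace_carrier])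
  show "br x y \<in> ?s ` ?G" if x: "x \<in> ?s ` ?G" and y: "y \<in> V" for x y
  proof -
    obtain g where g: "g \<in> ?G" "x = ?s g" using x by blast
    then have "br x y = ?s (\<lambda>k. br (g k) y)"
      using V[OF g(1)] y by (subst g(2), subst br_sum_left) auto
    then show ?thesis
      using J g y by (intro image_eqI[where x = "\<lambda>k. br (g k) y"]) (auto simp: ideal_def)
  qed
qed

section \<open>The orbit of a minimal ideal under the automorphism\<close>

context lie_automorphism
begin

lemma exists_cyclic_decomposition:
  assumes fin: "finite_dimensional_vector_space scale Basis"
    and nonabelian: "\<exists>x y. br x y \<noteq> 0"
    and irreducible: "\<And>K. \<lbrakk>ideal K; \<sigma> ` K \<subseteq> K\<rbrakk> \<Longrightarrow> K = {0} \<or> K = UNIV"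
  shows "\<exists>n I. cyclic_lie_automorphism scale br \<sigma> n I"
proof -
  interpret F: finite_dimensional_vector_space scale Basis by (fact fin)
  \<comment> \<open>An image \<open>\<sigma> x\<close> commutes with all \<open>\<sigma> u\<close>,
    and by surjectivity these are all elements.\<close>
  have "\<sigma> ` centre \<subseteq> centre"
  proof (intro subsetI, elim imageE)
    fix x y assume x: "x \<in> centre" "y = \<sigma> x"
    have "br (\<sigma> x) (\<sigma> u) = 0" for u
      using x by (simp add: centre_def automorphism_br[symmetric] automorphism_zero)
    then show "y \<in> centre"
      using x automorphism_surj unfolding centre_def by (simp add: surj_def) metis
  qed
  then have centre: "centre = {0}"
    using irreducible[OF ideal_centre] nonabelian by (auto simp: centre_def)
  have central: "x = 0" if "\<And>y. br x y = 0" for x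
    using that centre by (auto simp: centre_def)
  have nontrivial: "(UNIV :: 'a set) \<noteq> {0}"
    using nonabelian by (metis UNIV_I singletonD)
  \<comment> \<open>A nonzero ideal of least dimension: any nonzero ideal inside it has the same
    dimension and so equals it.\<close>
  obtain I where I: "ideal I" "I \<noteq> {0}"
    and I_least: "\<And>K. \<lbrakk>ideal K; K \<noteq> {0}\<rbrakk> \<Longrightarrow> dim I \<le> dim K"
    using ex_has_least_nat[of "\<lambda>K. ideal K \<and> K \<noteq> {0}" UNIV dim] ideal_carrier_whole nontrivial
    by blast
  have I_min: "minimal_ideal I"
    unfolding minimal_ideal_def
    using I I_least F.subspace_dim_equal ideal_subspace by metis
  define J where "J k = (\<sigma> ^^ k) ` I" for k
  have J_min: "minimal_ideal (J k)" for k
    unfolding J_def by (rule power_minimal_ideal[OF I_min])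
  then have J: "ideal (J k)" "J k \<noteq> {0}" "0 \<in> J k" for k
    using subspace_0 by (auto simp: minimal_ideal_def ideal_def)
  have J_Suc: "\<sigma> ` J k = J (Suc k)" for k
    by (simp add: J_def image_comp)
  \<comment> \<open>\<open>U m\<close> is the partial sum
    \<open>J 0 + ... + J (m - 1)\<close>.\<close>
  define U where "U m = (\<lambda>g. \<Sum>k<m. g k) ` {g. \<forall>k<m. g k \<in> J k}" for m
  have U_ideal: "ideal (U m)" for m
    unfolding U_def by (rule ideal_sum_image) (rule J)
  have U_add: "x + y \<in> U m" if "x \<in> U m" "y \<in> U m" for x y m
    using that ideal_subspace[OF U_ideal] subspace_add by blast
  have U_zero: "0 \<in> U m" for m
    using ideal_subspace[OF U_ideal] subspace_0 by blast
  have U_Suc: "U (Suc m) = {x + y |x y. x \<in> U m \<and> y \<in> J m}" for m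
  proof (intro equalityI subsetI)
    fix z assume "z \<in> U (Suc m)"
    then obtain g where "\<forall>k<Suc m. g k \<in> J k" "z = (\<Sum>k<m. g k) + g m"
      unfolding U_def by auto
    then have "(\<Sum>k<m. g k) \<in> U m" "g m \<in> J m" "z = (\<Sum>k<m. g k) + g m"
      unfolding U_def by auto
    then show "z \<in> {x + y |x y. x \<in> U m \<and> y \<in> J m}" by blast
  next
    fix z assume "z \<in> {x + y |x y. x \<in> U m \<and> y \<in> J m}"
    then obtain g y where g: "\<forall>k<m. g k \<in> J k" "y \<in> J m" "z = (\<Sum>k<m. g k) + y"
      unfolding U_def by auto
    then have "z = (\<Sum>k<Suc m. (g(m := y)) k)" by simp
    moreover have "\<forall>k<Suc m. (g(m := y)) k \<in> J k" using g by (simp add: less_Suc_eq)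
    ultimately show "z \<in> U (Suc m)" unfolding U_def by blast
  qed
  have U_mono: "U m \<subseteq> U (Suc m)" for m
    unfolding U_Suc using J(3) by (metis (mono_tags, lifting) add.right_neutral mem_Collect_eq subsetI)
  have J_subset: "J k \<subseteq> U m" if "k < m" for k m
  proof -
    have "J k \<subseteq> U (Suc k)"
      unfolding U_Suc using U_zero by (metis (mono_tags, lifting) add_0 mem_Collect_eq subsetI)
    also have "\<dots> \<subseteq> U m"
      using lift_Suc_mono_le[of U "Suc k" m, OF U_mono] that by simp
    finally show ?thesis .
  qed
  \<comment> \<open>\<open>\<sigma>\<close> sends \<open>J k\<close> to \<open>J (Suc k)\<close>, so
    only the last term could leave \<open>U m\<close>, and the assumption on \<open>J m\<close>
    prevents that. \<open>m \<ge> 1\<close> keeps \<open>U m\<close> nonzero.\<close>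
  have U_full: "U m = UNIV" if m: "m \<ge> 1" and Jm: "J m \<subseteq> U m" for m
  proof -
    have "\<sigma> (\<Sum>k<m. g k) \<in> U m" if g: "\<forall>k<m. g k \<in> J k" for g
      unfolding automorphism_sum
    proof (rule subspace_sum[OF ideal_subspace[OF U_ideal]])
      fix k assume "k \<in> {..<m}"
      then have "\<sigma> (g k) \<in> J (Suc k)" "Suc k < m \<or> Suc k = m"
        using g J_Suc by auto
      then show "\<sigma> (g k) \<in> U m" using J_subset Jm by blast
    qed
    then have "\<sigma> ` U m \<subseteq> U m" unfolding U_def by blast
    moreover have "U m \<noteq> {0}"
      using J_subset[of 0 m] m J(2,3)[of 0] by auto
    ultimately show ?thesis using irreducible[OF U_ideal] by blast
  qed
  have "\<exists>m. U m = UNIV"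
  proof (rule ccontr)
    assume no: "\<nexists>m. U m = UNIV"
    \<comment> \<open>By \<open>U_full\<close> the partial sums grow strictly as long as none is
      everything, which contradicts finite dimension. Counting starts at \<open>U 1\<close> because
      \<open>U_full\<close> asks for \<open>m \<ge> 1\<close>.\<close>
    have "m \<le> dim (U (Suc m))" for m
    proof (induction m)
      case (Suc m)
      have "\<not> J (Suc m) \<subseteq> U (Suc m)" using U_full no by (metis le_add1 plus_1_eq_Suc)
      then have "U (Suc m) \<noteq> U (Suc (Suc m))" using J_subset by blast
      then have "dim (U (Suc m)) < dim (U (Suc (Suc m)))"
        using U_mono[of "Suc m"] F.subspace_dim_equal[of "U (Suc m)" "U (Suc (Suc m))"] ideal_subspace[OF U_ideal]
        by (meson not_less)
      with Suc show ?case by simp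
    qed simp
    then show False using F.dim_subset_UNIV by (metis not_less_eq_eq order_trans)
  qed
  then obtain n where n: "U n = UNIV" and n_least: "\<And>m. U m = UNIV \<Longrightarrow> n \<le> m"
    using LeastI_ex[of "\<lambda>m. U m = UNIV"] Least_le[of "\<lambda>m. U m = UNIV"] by blast
  have n_pos: "n \<ge> 1"
    using n nontrivial by (cases n) (auto simp: U_def)
  \<comment> \<open>Cancelling \<open>\<sigma> ^^ i\<close> turns \<open>J i = J j\<close> into
    \<open>J (j - i) = J 0\<close>, which lies in \<open>U (j - i)\<close>. Hence
    \<open>U (j - i)\<close> is everything, and \<open>n\<close> is least with this
    property.\<close>
  have J_period: "n \<le> j - i" if "J i = J j" "i < j" for i j
  proof (rule n_least, rule U_full)
    have "(\<sigma> ^^ i) ` J (j - i) = (\<sigma> ^^ i) ` J 0"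
      using that by (simp add: J_def image_comp funpow_add[symmetric, unfolded o_def] comp_def)
    then have "J (j - i) = J 0" using power_inj by (simp add: inj_image_eq_iff)
    then show "J (j - i) \<subseteq> U (j - i)" using J_subset[of 0 "j - i"] that by simp
  qed (use that in simp)
  have comm: "br x y = 0" if "x \<in> J i" "y \<in> J j" "J i \<noteq> J j" for i j x y
    using minimal_ideals_commute[OF J_min J_min] that by blast
  \<comment> \<open>Otherwise \<open>J n\<close> would commute with every term of a sum representing
    any \<open>y\<close>, hence be central and zero.\<close>
  have "\<exists>i<n. J n = J i"
  proof (rule ccontr)
    assume no: "\<not> ?thesis"
    have "x = 0" if x: "x \<in> J n" for x
    proof (rule central)
      fix y
      obtain g where "\<forall>k<n. g k \<in> J k" "y = (\<Sum>k<n. g k)" using n unfolding U_def by blast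
      then show "br x y = 0" using x comm no by (auto simp: br_sum_right intro!: sum.neutral)
    qed
    then show False using J[of n] by auto
  qed
  then obtain i where i: "i < n" "J n = J i" by blast
  then have "i = 0" using J_period[of i n] by simp
  then have J_n: "J n = I" using i by (simp add: J_def)
  have J_distinct: "J i \<noteq> J j" if "i < n" "j < n" "i \<noteq> j" for i j
    using J_period[of i j] J_period[of j i] that by (cases "i < j") auto
  \<comment> \<open>Terms of \<open>y\<close> outside \<open>J 0\<close> are killed by
    \<open>x\<close>. An ideal of the algebra \<open>I\<close> is therefore an ideal of the whole
    algebra, and minimality of \<open>I\<close> becomes simplicity.\<close>
  have I_br: "\<exists>z\<in>I. br x y = br x z" if x: "x \<in> I" for x y
  proof -
    obtain g where g: "\<forall>k<n. g k \<in> J k" "y = (\<Sum>k<n. g k)" using n unfolding U_def by blast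
    have x0: "x \<in> J 0" using x by (simp add: J_def)
    have "br x y = (\<Sum>k<n. br x (g k))" using g by (simp add: br_sum_right)
    also have "\<dots> = (\<Sum>k<n. if k = 0 then br x (g 0) else 0)"
      using g comm[OF x0] J_distinct n_pos by (intro sum.cong) auto
    also have "\<dots> = br x (g 0)" using n_pos by simp
    finally have "br x y = br x (g 0)" .
    moreover have "g 0 \<in> I" using g(1) n_pos by (force simp: J_def)
    ultimately show ?thesis by blast
  qed
  interpret I: lie_algebra scale I br
    by (rule lie_subalgebra) (use I in \<open>auto simp: ideal_def\<close>)
  have "simple_anticommutative_algebra scale I br"
  proof unfold_locales
    obtain x where x: "x \<in> I" "x \<noteq> 0" using I I.zero_carrier by blast
    then show "\<exists>x\<in>I. \<exists>y\<in>I. br x y \<noteq> 0" using central I_br by metis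
    fix K assume K: "I.ideal K"
    then have "ideal K" unfolding ideal_def I.ideal_def using I_br by (metis subset_UNIV subsetD)
    then show "K = {0} \<or> K = I"
      using I_min K by (auto simp: minimal_ideal_def I.ideal_def)
  qed
  then have "simple_lie_algebra scale I br"
    using I.lie_algebra_axioms by (simp add: simple_lie_algebra_def)
  moreover have "\<exists>g. (\<forall>k. g k \<in> I) \<and> x = (\<Sum>k<n. (\<sigma> ^^ k) (g k))" for x
  proof -
    obtain f where f: "\<forall>k<n. f k \<in> J k" "x = (\<Sum>k<n. f k)" using n unfolding U_def by blast
    \<comment> \<open>A preimage is needed only for \<open>k < n\<close>; beyond that
      \<open>0\<close> keeps the coordinate in \<open>I\<close>.\<close>
    have "\<exists>y. y \<in> I \<and> (k < n \<longrightarrow> (\<sigma> ^^ k) y = f k)" for k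
      using f(1) I.zero_carrier unfolding J_def by (metis imageE)
    then obtain g where "\<And>k. g k \<in> I \<and> (k < n \<longrightarrow> (\<sigma> ^^ k) (g k) = f k)" by metis
    then show ?thesis using f(2) by (intro exI[of _ g]) auto
  qed
  moreover have "br ((\<sigma> ^^ i) x) ((\<sigma> ^^ j) y) = 0"
    if "i < n" "j < n" "i \<noteq> j" "x \<in> I" "y \<in> I" for i j x y
    using comm[of _ i _ j] J_distinct[of i j] that by (simp add: J_def)
  ultimately have "cyclic_lie_automorphism scale br \<sigma> n I"
    using n_pos J_n
    by (intro cyclic_lie_automorphism.intro lie_automorphism_axioms cyclic_lie_automorphism_axioms.intro)
      (simp_all add: J_def)
  then show ?thesis by blast
qed

end

section \<open>Extending isomorphisms of components\<close>

text \<open>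
  The extension is \<open>\<eta>\<^sup>k \<circ> \<phi> \<circ> \<sigma>\<^sup>-\<^sup>k\<close> on \<open>\<sigma>\<^sup>k(I)\<close>; the conjugacy of the \<open>n\<close>-th powers is what makes
  it commute with the twists when passing from \<open>\<sigma>\<^sup>n\<^sup>-\<^sup>1(I)\<close> back to \<open>I\<close>.
\<close>

lemma component_iso_extends:
  assumes A: "cyclic_lie_automorphism scaleA brA \<sigma> n I"
    and B: "cyclic_lie_automorphism scaleB brB \<eta> n J"
    and iso: "algebra_iso scaleA I brA scaleB J brB \<phi>"
    and conj: "\<And>x. x \<in> I \<Longrightarrow> \<phi> ((\<sigma> ^^ n) x) = (\<eta> ^^ n) (\<phi> x)"
  shows "\<exists>\<Phi>. algebra_iso scaleA UNIV brA scaleB UNIV brB \<Phi> \<and> \<Phi> \<circ> \<sigma> = \<eta> \<circ> \<Phi>"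
proof -
  interpret A: cyclic_lie_automorphism scaleA brA \<sigma> n I by fact
  interpret B: cyclic_lie_automorphism scaleB brB \<eta> n J by fact
  interpret I: simple_lie_algebra scaleA I brA by (fact A.component_simple)
  interpret J: simple_lie_algebra scaleB J brB by (fact B.component_simple)
  interpret \<phi>: algebra_isomorphism scaleA I brA scaleB J brB \<phi>
    by unfold_locales (fact iso)
  define asmA where "asmA g = (\<Sum>k<n. (\<sigma> ^^ k) (g k))" for g
  define asmB where "asmB g = (\<Sum>k<n. (\<eta> ^^ k) (g k))" for g
  \<comment> \<open>The choice is determined only for indices below \<open>n\<close>; later values
    are arbitrary elements of \<open>I\<close>, which \<open>asmA\<close> and \<open>asmB\<close> do
    not see.\<close>
  define coord where "coord x = (SOME g. (\<forall>k. g k \<in> I) \<and> x = asmA g)" for x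
  define \<Phi> where "\<Phi> x = asmB (\<lambda>k. \<phi> (coord x k))" for x
  have coord: "coord x k \<in> I" "asmA (coord x) = x" for x k
    using someI_ex[OF A.components_span[of x]] unfolding coord_def asmA_def by auto
  have \<Phi>: "\<Phi> (asmA g) = asmB (\<lambda>k. \<phi> (g k))" if "\<And>k. g k \<in> I" for g
    unfolding \<Phi>_def asmB_def
    using A.components_unique[of "coord (asmA g)" g] that coord coord(2)[unfolded asmA_def]
    by (intro sum.cong) (auto simp: asmA_def)
  have add: "\<Phi> (x + y) = \<Phi> x + \<Phi> y" for x y
  proof -
    have "x + y = asmA (\<lambda>k. coord x k + coord y k)"
      using coord(2)[of x] coord(2)[of y] by (simp add: asmA_def A.power_add sum.distrib)
    then have "\<Phi> (x + y) = asmB (\<lambda>k. \<phi> (coord x k + coord y k))"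
      using \<Phi> coord I.add_carrier by simp
    then show ?thesis
      by (simp add: \<Phi>_def asmB_def \<phi>.iso_add coord B.power_add sum.distrib)
  qed
  have scale: "\<Phi> (scaleA c x) = scaleB c (\<Phi> x)" for c x
  proof -
    have "scaleA c x = asmA (\<lambda>k. scaleA c (coord x k))"
      using coord(2)[of x] by (simp add: asmA_def A.power_scale A.scale_sum_right[symmetric])
    then have "\<Phi> (scaleA c x) = asmB (\<lambda>k. \<phi> (scaleA c (coord x k)))"
      using \<Phi> coord I.scale_carrier by simp
    then show ?thesis
      by (simp add: \<Phi>_def asmB_def \<phi>.iso_scale coord B.power_scale B.scale_sum_right)
  qed
  have br: "\<Phi> (brA x y) = brB (\<Phi> x) (\<Phi> y)" for x y
  proof -
    have "brA x y = asmA (\<lambda>k. brA (coord x k) (coord y k))"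
      using A.br_components[of "coord x" "coord y"] coord by (simp add: asmA_def)
    then have "\<Phi> (brA x y) = asmB (\<lambda>k. \<phi> (brA (coord x k) (coord y k)))"
      using \<Phi> coord I.br_closed by simp
    then show ?thesis
      by (simp add: \<Phi>_def asmB_def \<phi>.iso_br coord B.br_components \<phi>.iso_closed)
  qed
  have "x = 0" if "\<Phi> x = 0" for x
  proof -
    have "\<phi> (coord x k) = 0" if "k < n" for k
      using B.components_unique[of "\<lambda>k. \<phi> (coord x k)" "\<lambda>_. 0" k] \<open>\<Phi> x = 0\<close> that
      by (simp add: \<Phi>_def asmB_def coord \<phi>.iso_closed J.zero_carrier B.power_zero)
    then have "asmA (coord x) = 0"
      by (simp add: asmA_def \<phi>.iso_eq_zero coord A.power_zero)
    then show ?thesis by (simp add: coord)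
  qed
  moreover have "\<Phi> (x - y) = \<Phi> x - \<Phi> y" for x y
    using add[of "x - y" y] by (simp add: algebra_simps)
  ultimately have "inj \<Phi>" by (intro injI) (metis right_minus_eq)
  moreover have "surj \<Phi>"
  proof (rule surjI)
    fix y
    obtain h where h: "\<And>k. h k \<in> J" "y = asmB h"
      using B.components_span unfolding asmB_def by blast
    have "inv_into I \<phi> (h k) \<in> I" "\<phi> (inv_into I \<phi> (h k)) = h k" for k
      using h \<phi>.iso_image by (auto intro: inv_into_into f_inv_into_f)
    then have "\<Phi> (asmA (\<lambda>k. inv_into I \<phi> (h k))) = y"
      using \<Phi>[of "\<lambda>k. inv_into I \<phi> (h k)"] h by simp
    then show "\<Phi> (inv \<Phi> y) = y" by (metis f_inv_into_f rangeI)
  qed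
  ultimately have "algebra_iso scaleA UNIV brA scaleB UNIV brB \<Phi>"
    unfolding algebra_iso_def bij_betw_def using add scale br by blast
  moreover have "\<Phi> (\<sigma> x) = \<eta> (\<Phi> x)" for x
  proof -
    \<comment> \<open>These are the coordinates of \<open>\<sigma> x\<close>. At the wrapped entry
      0, \<open>conj\<close> moves \<open>\<phi>\<close> past the \<open>n\<close>-th power.\<close>
    define g where "g k = (case k of 0 \<Rightarrow> (\<sigma> ^^ n) (coord x (n - 1)) | Suc m \<Rightarrow> coord x m)" for k
    have g: "g k \<in> I" for k
      using coord A.power_image by (auto simp: g_def split: nat.split)
    have "\<sigma> x = asmA g"
      using A.automorphism_components[of "coord x"] coord by (simp add: asmA_def g_def)
    then have "\<Phi> (\<sigma> x) = asmB (\<lambda>k. \<phi> (g k))"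
      using \<Phi> g by simp
    also have "\<dots> = asmB (\<lambda>k. case k of 0 \<Rightarrow> (\<eta> ^^ n) (\<phi> (coord x (n - 1))) | Suc m \<Rightarrow> \<phi> (coord x m))"
      unfolding asmB_def by (intro sum.cong) (auto simp: g_def conj coord split: nat.split)
    also have "\<dots> = \<eta> (\<Phi> x)"
      using B.automorphism_components[of "\<lambda>k. \<phi> (coord x k)"] coord \<phi>.iso_closed
      by (simp add: asmB_def \<Phi>_def)
    finally show ?thesis .
  qed
  ultimately show ?thesis by (auto simp: fun_eq_iff)
qed

section \<open>Cyclic Yau twists\<close>

text \<open>Mapping the \<open>k\<close>-th power of the cycle over \<open>cs\<close> rotates the
  list by \<open>k\<close>; the claim compares the entries at \<open>m\<close>.\<close>

lemma cycle_of_list_power_nth: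
  assumes "cycle cs" "m < length cs"
  shows "(cycle_of_list cs ^^ k) (cs ! m) = cs ! ((k + m) mod length cs)"
  using assms cyclic_rotation[OF assms(1), of k] nth_rotate[OF assms(2), of k]
  by (metis nth_map)

text \<open>Any summand may serve as the starting component, as the isomorphism criterion allows
  arbitrary indices \<open>i\<close> and \<open>j\<close>.\<close>

lemma cyclic_yau_twist_imp_cyclic_lie_automorphism:
  assumes twist: "cyclic_yau_twist scale br \<sigma> n lbr S T tbr" and i: "i \<in> {1..n}"
  shows "cyclic_lie_automorphism scale lbr \<sigma> n (S i)"
proof -
  have L: "lie_algebra scale UNIV lbr"
    and summand: "\<And>j. j \<in> {1..n} \<Longrightarrow> lie_algebra scale (S j) lbr"
    and decomp: "\<And>x. \<exists>f. f \<in> PiE {1..n} S \<and> x = (\<Sum>j=1..n. f j)"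
    and comm: "\<And>j k x y. \<lbrakk>j \<in> {1..n}; k \<in> {1..n}; j \<noteq> k; x \<in> S j; y \<in> S k\<rbrakk> \<Longrightarrow> lbr x y = 0"
    and copy: "\<And>j. j \<in> {1..n} \<Longrightarrow> \<exists>\<psi>. algebra_iso scale (S j) lbr scale T tbr \<psi>"
    and aut: "algebra_iso scale UNIV lbr scale UNIV lbr \<sigma>"
    and T: "simple_lie_algebra scale T tbr" and n: "n \<ge> 1"
    using twist unfolding cyclic_yau_twist_def direct_sum_of_copies_def by blast+
  obtain cs where cs: "cycle cs" "set cs = {1..n}"
    and \<sigma>: "\<And>j. j \<in> {1..n} \<Longrightarrow> \<sigma> ` S j = S (cycle_of_list cs j)"
    using twist unfolding cyclic_yau_twist_def permutes_summands_cyclically_def by blast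
  have len: "length cs = n"
    using distinct_card[OF cs(1)] cs(2) by simp
  obtain m where m: "m < n" "cs ! m = i"
    using i cs len by (metis in_set_conv_nth)
  \<comment> \<open>\<open>\<tau> k\<close> indexes the summand reached from \<open>S i\<close>
    after \<open>k\<close> applications of \<open>\<sigma>\<close>; the position \<open>m\<close> of
    \<open>i\<close> in \<open>cs\<close> reduces it to arithmetic modulo \<open>n\<close>.\<close>
  define \<tau> where "\<tau> k = (cycle_of_list cs ^^ k) i" for k
  have \<tau>: "\<tau> k = cs ! ((k + m) mod n)" for k
    using cycle_of_list_power_nth[of cs m k] cs m len by (simp add: \<tau>_def)
  have \<tau>_mem: "\<tau> k \<in> {1..n}" for k
    using \<tau> cs len n by (metis One_nat_def Suc_le_lessD mod_less_divisor nth_mem)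
  have \<tau>_image: "(\<sigma> ^^ k) ` S i = S (\<tau> k)" for k
  proof (induction k)
    case 0
    show ?case by (simp add: \<tau>_def)
  next
    case (Suc k)
    have "(\<sigma> ^^ Suc k) ` S i = \<sigma> ` (\<sigma> ^^ k) ` S i" by (simp add: image_comp)
    also have "\<dots> = S (\<tau> (Suc k))" using Suc \<sigma>[OF \<tau>_mem[of k]] by (simp add: \<tau>_def)
    finally show ?case .
  qed
  have \<tau>_inj: "inj_on \<tau> {..<n}"
  proof (rule inj_onI)
    fix j k assume jk: "j \<in> {..<n}" "k \<in> {..<n}" "\<tau> j = \<tau> k"
    then have "(j + m) mod n = (k + m) mod n"
      using \<tau> cs(1) len n by (metis One_nat_def Suc_le_lessD mod_less_divisor nth_eq_iff_index_eq)
    then have "j mod n = k mod n"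
      unfolding nat_mod_eq_iff by auto
    then show "j = k" using jk by simp
  qed
  \<comment> \<open>An injection between sets of size \<open>n\<close> is a bijection, so the orbit
    of \<open>S i\<close> exhausts the summands.\<close>
  have \<tau>_bij: "bij_betw \<tau> {..<n} {1..n}"
    using \<tau>_inj \<tau>_mem by (intro bij_betw_imageI card_subset_eq) (auto simp: card_image)
  interpret L: lie_algebra scale UNIV lbr by (fact L)
  interpret Si: lie_algebra scale "S i" lbr by (fact summand[OF i])
  interpret T: simple_lie_algebra scale T tbr by (fact T)
  obtain \<psi> where \<psi>: "algebra_iso scale (S i) lbr scale T tbr \<psi>"
    using copy[OF i] by blast
  interpret \<psi>: algebra_isomorphism scale "S i" lbr scale T tbr \<psi>
    by unfold_locales (fact \<psi>)
  have "simple_anticommutative_algebra scale (S i) lbr"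
    using algebra_isomorphism.simple_transfer[OF \<psi>.algebra_isomorphism_inv]
      T.simple_anticommutative_algebra_axioms by blast
  then have simple: "simple_lie_algebra scale (S i) lbr"
    using Si.lie_algebra_axioms by (simp add: simple_lie_algebra_def)
  show ?thesis
  proof (intro cyclic_lie_automorphism.intro lie_automorphism.intro lie_automorphism_axioms.intro
      cyclic_lie_automorphism_axioms.intro)
    show "lie_algebra scale UNIV lbr" by (fact L)
    show "algebra_iso scale UNIV lbr scale UNIV lbr \<sigma>" by (fact aut)
    show "1 \<le> n" by (fact n)
    show "simple_lie_algebra scale (S i) lbr" by (fact simple)
    show "(\<sigma> ^^ n) ` S i = S i"
      using \<tau>_image[of n] \<tau>[of n] m by simp
    show "lbr ((\<sigma> ^^ j) x) ((\<sigma> ^^ k) y) = 0"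
      if "j < n" "k < n" "j \<noteq> k" "x \<in> S i" "y \<in> S i" for j k x y
      using comm[OF \<tau>_mem \<tau>_mem] \<tau>_inj that \<tau>_image by (metis imageI inj_onD lessThan_iff)
    fix x
    obtain f where f: "f \<in> PiE {1..n} S" "x = (\<Sum>j=1..n. f j)"
      using decomp by blast
    have "\<exists>y. y \<in> S i \<and> (\<sigma> ^^ k) y = f (\<tau> k)" for k
      using f(1) \<tau>_mem[of k] \<tau>_image[of k] by (metis PiE_mem imageE)
    then obtain g where g: "\<And>k. g k \<in> S i \<and> (\<sigma> ^^ k) (g k) = f (\<tau> k)"
      by metis
    then have "x = (\<Sum>k<n. (\<sigma> ^^ k) (g k))"
      using f(2) sum.reindex_bij_betw[OF \<tau>_bij, of f] by simp
    with g show "\<exists>g. (\<forall>k. g k \<in> S i) \<and> x = (\<Sum>k<n. (\<sigma> ^^ k) (g k))"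
      by (intro exI[of _ g]) simp
  qed
qed

text \<open>The cycle maps its support onto itself, so the orbit never leaves the listed summands.
  This turns a component found as an image under a power into an indexed summand.\<close>

lemma power_image_summand:
  assumes "permutes_summands_cyclically n S \<sigma>" and "i \<in> {1..n}"
  shows "\<exists>j\<in>{1..n}. (\<sigma> ^^ k) ` S i = S j"
proof (induction k)
  case 0
  show ?case using assms(2) by auto
next
  case (Suc k)
  then obtain j where j: "j \<in> {1..n}" "(\<sigma> ^^ k) ` S i = S j" by blast
  obtain cs where cs: "cycle cs" "set cs = {1..n}" "\<sigma> ` S j = S (cycle_of_list cs j)"
    using assms(1) j(1) unfolding permutes_summands_cyclically_def by blast
  have "(\<sigma> ^^ Suc k) ` S i = \<sigma> ` (\<sigma> ^^ k) ` S i" by (simp add: image_comp)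
  then have "(\<sigma> ^^ Suc k) ` S i = S (cycle_of_list cs j)" using cs(3) j(2) by simp
  moreover have "cycle_of_list cs j \<in> {1..n}"
    using cycle_is_surj[OF cs(1)] cs(2) j(1) by blast
  ultimately show ?case by blast
qed

lemma cycle_of_list_upt:
  assumes "i \<in> {1..n}"
  shows "cycle_of_list [1..<Suc n] i = (if i = n then 1 else Suc i)"
  using cycle_of_list_power_nth[of "[1..<Suc n]" "i - 1" 1] assms
  by (cases "i = n") (auto simp del: upt_Suc)

text \<open>Components are counted from 0 but summands from 1, whence the exponent
  \<open>i - 1\<close>. The model \<open>T\<close> is \<open>I\<close> itself.\<close>

lemma (in cyclic_lie_automorphism) cyclic_yau_twist:
  "cyclic_yau_twist scale (yau_twist br \<sigma>) \<sigma> n br (\<lambda>i. (\<sigma> ^^ (i - 1)) ` I) I br"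
proof -
  let ?S = "\<lambda>i. (\<sigma> ^^ (i - 1)) ` I"
  interpret I: simple_lie_algebra scale I br
    by (fact component_simple)
  have "direct_sum_of_copies scale br n ?S I br"
    unfolding direct_sum_of_copies_def
  proof (intro conjI ballI allI impI)
    show "lie_algebra scale UNIV br" by (fact lie_algebra_axioms)
    show "lie_algebra scale (?S i) br" for i
    proof (rule lie_subalgebra)
      show "subspace (?S i)"
        using power_ideal component_minimal by (simp add: minimal_ideal_def ideal_def)
      fix x y assume "x \<in> ?S i" "y \<in> ?S i"
      then show "br x y \<in> ?S i"
        by (auto simp: power_br[symmetric] I.br_closed)
    qed simp
    show "br x y = 0" if "i \<in> {1..n}" "j \<in> {1..n}" "i \<noteq> j" "x \<in> ?S i" "y \<in> ?S j" for i j x y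
      using that components_commute[of "i - 1" "j - 1"] by auto
    show "\<exists>\<psi>. algebra_iso scale (?S i) br scale I br \<psi>" for i
    proof -
      have "algebra_iso scale I br scale (?S i) br (\<sigma> ^^ (i - 1))"
        using algebra_iso_restrict[OF algebra_iso_funpow[OF automorphism]] by blast
      then have "algebra_isomorphism scale I br scale (?S i) br (\<sigma> ^^ (i - 1))"
        using \<open>\<And>i. lie_algebra scale (?S i) br\<close> I.anticommutative_algebra_axioms
        by (simp add: algebra_isomorphism_def algebra_isomorphism_axioms_def lie_algebra_def)
      then show ?thesis using algebra_isomorphism.algebra_iso_inv by blast
    qed
    fix x
    obtain g where g: "\<And>k. g k \<in> I" "x = (\<Sum>k<n. (\<sigma> ^^ k) (g k))"
      using components_span by blast
    show "\<exists>!f. f \<in> PiE {1..n} ?S \<and> x = (\<Sum>i=1..n. f i)"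
    \<comment> \<open>\<open>restrict\<close> supplies the value \<open>undefined\<close> outside
      \<open>{1..n}\<close> that \<open>PiE\<close> demands. Uniqueness is
      \<open>components_unique\<close> after shifting indices.\<close>
    proof (rule ex1I[where a = "restrict (\<lambda>i. (\<sigma> ^^ (i - 1)) (g (i - 1))) {1..n}"])
      show "restrict (\<lambda>i. (\<sigma> ^^ (i - 1)) (g (i - 1))) {1..n} \<in> PiE {1..n} ?S \<and>
          x = (\<Sum>i=1..n. restrict (\<lambda>i. (\<sigma> ^^ (i - 1)) (g (i - 1))) {1..n} i)"
        using g by (auto simp: sum.atLeast1_atMost_eq)
      fix f assume f: "f \<in> PiE {1..n} ?S \<and> x = (\<Sum>i=1..n. f i)"
      have "\<exists>y. y \<in> I \<and> (k < n \<longrightarrow> (\<sigma> ^^ k) y = f (Suc k))" for k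
      proof (cases "k < n")
        case True
        then have "f (Suc k) \<in> (\<sigma> ^^ k) ` I"
          using f PiE_mem[of f "{1..n}" ?S "Suc k"] by simp
        then show ?thesis by (metis imageE)
      qed (use I.zero_carrier in auto)
      then obtain h where h: "\<And>k. h k \<in> I" "\<And>k. k < n \<Longrightarrow> (\<sigma> ^^ k) (h k) = f (Suc k)"
        by metis
      have "(\<Sum>k<n. (\<sigma> ^^ k) (h k)) = x"
        using f h by (simp add: sum.atLeast1_atMost_eq)
      then have eq: "h k = g k" if "k < n" for k
        using components_unique[of h g k] g h that by simp
      show "f = restrict (\<lambda>i. (\<sigma> ^^ (i - 1)) (g (i - 1))) {1..n}"
      proof (rule PiE_ext)
        show "f \<in> PiE {1..n} ?S" using f by blast
        show "restrict (\<lambda>i. (\<sigma> ^^ (i - 1)) (g (i - 1))) {1..n} \<in> PiE {1..n} ?S" using g by auto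
        fix i assume i: "i \<in> {1..n}"
        then have "i - 1 < n" by auto
        then show "f i = restrict (\<lambda>i. (\<sigma> ^^ (i - 1)) (g (i - 1))) {1..n} i"
          using i h(2)[of "i - 1"] eq[of "i - 1"] by simp
      qed
    qed
  qed
  moreover have "permutes_summands_cyclically n ?S \<sigma>"
    unfolding permutes_summands_cyclically_def
  proof (intro exI[of _ "[1..<Suc n]"] conjI ballI)
    fix i assume i: "i \<in> {1..n}"
    then have "\<sigma> ` ?S i = (\<sigma> ^^ i) ` I"
      by (cases i) (auto simp: image_comp)
    \<comment> \<open>For \<open>i = n\<close> the cycle closes because \<open>\<sigma> ^^ n\<close>
      maps \<open>I\<close> onto itself.\<close>
    then show "\<sigma> ` ?S i = ?S (cycle_of_list [1..<Suc n] i)"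
      unfolding cycle_of_list_upt[OF i] using power_image by auto
  qed auto
  ultimately show ?thesis
    unfolding cyclic_yau_twist_def using n_pos component_simple automorphism by blast
qed

text \<open>Commutation with the twists puts both sides of the bracket condition behind
  \<open>\<eta>\<close>, which is injective and cancels.\<close>

lemma hom_lie_iso_yau_twist_iff:
  assumes "lie_automorphism scaleA lbrA \<sigma>" "lie_automorphism scaleB lbrB \<eta>"
  shows "hom_lie_iso scaleA (yau_twist lbrA \<sigma>) \<sigma> scaleB (yau_twist lbrB \<eta>) \<eta> \<Phi> \<longleftrightarrow>
    algebra_iso scaleA UNIV lbrA scaleB UNIV lbrB \<Phi> \<and> \<Phi> \<circ> \<sigma> = \<eta> \<circ> \<Phi>"
proof -
  have "\<Phi> (yau_twist lbrA \<sigma> x y) = yau_twist lbrB \<eta> (\<Phi> x) (\<Phi> y) \<longleftrightarrow>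
      \<Phi> (lbrA x y) = lbrB (\<Phi> x) (\<Phi> y)" if "\<Phi> \<circ> \<sigma> = \<eta> \<circ> \<Phi>" for x y
    using that lie_automorphism.automorphism_inj[OF assms(2)]
    by (simp add: yau_twist_def fun_eq_iff inj_eq)
  then show ?thesis
    unfolding hom_lie_iso_def algebra_iso_def by blast
qed

text \<open>Forward, the restriction of \<open>\<Phi>\<close> to \<open>S 1\<close> is the
  conjugating \<open>\<phi>\<close>. Backward, \<open>component_iso_extends\<close> applies with
  \<open>S i\<close> and \<open>S' j\<close> as starting components.\<close>

lemma cyclic_yau_twist_iso_iff:
  assumes twistA: "cyclic_yau_twist scaleA brA \<sigma> n lbrA S T tbr"
    and twistB: "cyclic_yau_twist scaleB brB \<eta> n lbrB S' T' tbr'"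
  shows "(\<exists>\<Phi>. hom_lie_iso scaleA brA \<sigma> scaleB brB \<eta> \<Phi>) \<longleftrightarrow>
    (\<exists>i\<in>{1..n}. \<exists>j\<in>{1..n}. \<exists>\<phi>. algebra_iso scaleA (S i) lbrA scaleB (S' j) lbrB \<phi> \<and>
      (\<forall>x\<in>S i. (\<sigma> ^^ n) x = inv_into (S i) \<phi> ((\<eta> ^^ n) (\<phi> x))))"
    (is "?L \<longleftrightarrow> ?R")
proof -
  note cycA = cyclic_yau_twist_imp_cyclic_lie_automorphism[OF twistA]
    and cycB = cyclic_yau_twist_imp_cyclic_lie_automorphism[OF twistB]
  have n: "n \<ge> 1" and br: "brA = yau_twist lbrA \<sigma>" "brB = yau_twist lbrB \<eta>"
    using twistA twistB by (auto simp: cyclic_yau_twist_def)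
  then have one: "1 \<in> {1..n}" by simp
  interpret A: cyclic_lie_automorphism scaleA lbrA \<sigma> n "S 1" by (rule cycA[OF one])
  interpret B: cyclic_lie_automorphism scaleB lbrB \<eta> n "S' 1" by (rule cycB[OF one])
  have iso_iff: "?L \<longleftrightarrow> (\<exists>\<Phi>. algebra_iso scaleA UNIV lbrA scaleB UNIV lbrB \<Phi> \<and> \<Phi> \<circ> \<sigma> = \<eta> \<circ> \<Phi>)"
    unfolding br using hom_lie_iso_yau_twist_iff A.lie_automorphism_axioms B.lie_automorphism_axioms
    by blast
  show ?thesis
    unfolding iso_iff
  proof
    assume "\<exists>\<Phi>. algebra_iso scaleA UNIV lbrA scaleB UNIV lbrB \<Phi> \<and> \<Phi> \<circ> \<sigma> = \<eta> \<circ> \<Phi>"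
    then obtain \<Phi> where \<Phi>: "algebra_iso scaleA UNIV lbrA scaleB UNIV lbrB \<Phi>" "\<Phi> \<circ> \<sigma> = \<eta> \<circ> \<Phi>"
      by blast
    interpret \<Phi>: algebra_isomorphism scaleA UNIV lbrA scaleB UNIV lbrB \<Phi>
      by unfold_locales (fact \<Phi>)
    have comm: "\<Phi> ((\<sigma> ^^ k) x) = (\<eta> ^^ k) (\<Phi> x)" for k x
      using \<Phi>(2) by (induction k) (simp_all add: fun_eq_iff)
    obtain k where k: "k < n" "\<Phi> ` S 1 = (\<eta> ^^ k) ` S' 1"
      using B.minimal_ideal_cases[OF \<Phi>.minimal_ideal_image[OF A.component_minimal]] by blast
    moreover have "permutes_summands_cyclically n S' \<eta>"
      using twistB by (simp add: cyclic_yau_twist_def)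
    ultimately obtain j where j: "j \<in> {1..n}" "\<Phi> ` S 1 = S' j"
      using power_image_summand[OF _ one] by metis
    have "algebra_iso scaleA (S 1) lbrA scaleB (S' j) lbrB \<Phi>"
      using algebra_iso_restrict[OF \<Phi>(1), of "S 1"] j by simp
    moreover have "(\<sigma> ^^ n) x = inv_into (S 1) \<Phi> ((\<eta> ^^ n) (\<Phi> x))" if "x \<in> S 1" for x
    proof -
      have "(\<sigma> ^^ n) x \<in> S 1" using A.power_image that by blast
      then show ?thesis
        using \<Phi>.iso_inj by (simp add: comm[symmetric] inj_on_subset)
    qed
    ultimately show ?R using one j(1) by blast
  next
    assume ?R
    then obtain i j \<phi> where ij: "i \<in> {1..n}" "j \<in> {1..n}"
      and \<phi>: "algebra_iso scaleA (S i) lbrA scaleB (S' j) lbrB \<phi>"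
      and conj: "\<And>x. x \<in> S i \<Longrightarrow> (\<sigma> ^^ n) x = inv_into (S i) \<phi> ((\<eta> ^^ n) (\<phi> x))"
      by blast
    show "\<exists>\<Phi>. algebra_iso scaleA UNIV lbrA scaleB UNIV lbrB \<Phi> \<and> \<Phi> \<circ> \<sigma> = \<eta> \<circ> \<Phi>"
    proof (rule component_iso_extends[OF cycA[OF ij(1)] cycB[OF ij(2)] \<phi>])
      fix x assume x: "x \<in> S i"
      \<comment> \<open>\<open>\<phi>\<close> undoes \<open>inv_into (S i) \<phi>\<close> only on
        \<open>S' j\<close>.\<close>
      have "(\<eta> ^^ n) (\<phi> x) \<in> S' j"
        using cyclic_lie_automorphism.power_image[OF cycB[OF ij(2)]] algebra_isoD(7)[OF \<phi> x] by blast
      then show "\<phi> ((\<sigma> ^^ n) x) = (\<eta> ^^ n) (\<phi> x)"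
        using conj[OF x] algebra_isoD(6)[OF \<phi>] by (simp add: f_inv_into_f)
    qed
  qed
qed

section \<open>Simple multiplicative Hom-Lie algebras\<close>

text \<open>Multiplicativity makes the kernel closed under brackets; finite dimension upgrades an
  injective twist to a bijective one.\<close>

lemma simple_multiplicative_twist_cases:
  assumes fin: "finite_dimensional_vector_space scale Basis"
    and mult: "multiplicative_hom_lie_algebra scale br \<sigma>"
    and simple: "simple_hom_lie_algebra scale br \<sigma>"
  shows "\<sigma> = (\<lambda>_. 0) \<or> bij \<sigma>"
proof -
  interpret M: multiplicative_hom_lie_algebra scale br \<sigma> by (fact mult)
  interpret S: simple_hom_lie_algebra scale br \<sigma> by (fact simple)
  interpret F: finite_dimensional_vector_space scale Basis by (fact fin)
  interpret \<sigma>: Vector_Spaces.linear scale scale \<sigma> by (fact M.linear_twist)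
  have "M.hom_ideal {x. \<sigma> x = 0}"
    unfolding M.hom_ideal_def
    by (auto simp: \<sigma>.subspace_kernel M.multiplicative M.br_zero_left \<sigma>.zero)
  then consider "{x. \<sigma> x = 0} = {0}" | "{x. \<sigma> x = 0} = UNIV"
    using S.hom_ideal_trivial by blast
  then show ?thesis
  proof cases
    case 1
    then have "inj \<sigma>" by (auto simp: \<sigma>.inj_iff_eq_0)
    then show ?thesis using F.linear_inj_imp_surj[OF M.linear_twist] by (simp add: bij_def)
  qed auto
qed

lemma untwisted_lie_automorphism:
  assumes mult: "multiplicative_hom_lie_algebra scale br \<sigma>" and bij: "bij \<sigma>"
  shows "lie_automorphism scale (\<lambda>x y. inv \<sigma> (br x y)) \<sigma>"
proof -
  interpret M: multiplicative_hom_lie_algebra scale br \<sigma> by (fact mult)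
  interpret \<sigma>: Vector_Spaces.linear scale scale \<sigma> by (fact M.linear_twist)
  have right: "\<sigma> (inv \<sigma> u) = u" for u
    using bij by (simp add: bij_def surj_f_inv_f)
  have left: "inv \<sigma> (\<sigma> u) = u" for u
    using bij by (simp add: bij_def)
  have inv_add: "inv \<sigma> (u + v) = inv \<sigma> u + inv \<sigma> v" for u v
    using left[of "inv \<sigma> u + inv \<sigma> v"] by (simp add: \<sigma>.add right)
  have inv_scale: "inv \<sigma> (scale c u) = scale c (inv \<sigma> u)" for c u
    using left[of "scale c (inv \<sigma> u)"] by (simp add: \<sigma>.scale right)
  have inv_zero: "inv \<sigma> 0 = 0"
    using left[of 0] by (simp add: \<sigma>.zero)
  \<comment> \<open>Multiplicativity moves \<open>inv \<sigma>\<close> out of the bracket, so the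
    Jacobi sum becomes \<open>inv \<sigma>\<close> applied twice to the Hom-Jacobi sum.\<close>
  have br_inv: "br x (inv \<sigma> y) = inv \<sigma> (br (\<sigma> x) y)" for x y
    using left[of "br x (inv \<sigma> y)"] by (simp add: right M.multiplicative)
  show ?thesis
  proof unfold_locales
    show "inv \<sigma> (br x (inv \<sigma> (br y z))) + inv \<sigma> (br y (inv \<sigma> (br z x)))
        + inv \<sigma> (br z (inv \<sigma> (br x y))) = 0" for x y z
      by (simp add: br_inv M.hom_jacobi inv_zero flip: inv_add)
    show "algebra_iso scale UNIV (\<lambda>x y. inv \<sigma> (br x y)) scale UNIV (\<lambda>x y. inv \<sigma> (br x y)) \<sigma>"
      unfolding algebra_iso_def using bij
      by (simp add: \<sigma>.add \<sigma>.scale right left flip: M.multiplicative)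
  qed (simp_all add: inv_add inv_scale inv_zero M.br_add_left M.br_add_right
      M.br_scale_left M.br_scale_right M.br_self)
qed

lemma simple_hom_lie_bijective_twist:
  assumes fin: "finite_dimensional_vector_space scale Basis"
    and mult: "multiplicative_hom_lie_algebra scale br \<sigma>"
    and simple: "simple_hom_lie_algebra scale br \<sigma>" and bij: "bij \<sigma>"
  shows "\<exists>n lbr S T tbr. cyclic_yau_twist scale br \<sigma> n lbr S T tbr"
proof -
  interpret S: simple_hom_lie_algebra scale br \<sigma> by (fact simple)
  define lbr where "lbr x y = inv \<sigma> (br x y)" for x y
  have br: "br = yau_twist lbr \<sigma>"
    using bij by (simp add: yau_twist_def lbr_def fun_eq_iff bij_def surj_f_inv_f)
  interpret L: lie_automorphism scale lbr \<sigma>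
    using untwisted_lie_automorphism[OF mult bij] by (simp add: lbr_def[abs_def])
  have "\<exists>n I. cyclic_lie_automorphism scale lbr \<sigma> n I"
  proof (rule L.exists_cyclic_decomposition[OF fin])
    show "\<exists>x y. lbr x y \<noteq> 0"
      using S.not_abelian L.automorphism_zero by (metis br yau_twist_def)
    \<comment> \<open>As \<open>br x y\<close> is \<open>\<sigma> (lbr x y)\<close>, an invariant
      ideal of the Lie algebra is a Hom-ideal.\<close>
    fix K assume "L.ideal K" "\<sigma> ` K \<subseteq> K"
    then have "S.hom_ideal K"
      unfolding S.hom_ideal_def by (auto simp: L.ideal_def br yau_twist_def)
    then show "K = {0} \<or> K = UNIV" by (rule S.hom_ideal_trivial)
  qed
  then show ?thesis
    unfolding br using cyclic_lie_automorphism.cyclic_yau_twist by blast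
qed

text \<open>Every subspace is invariant under the zero map, so ideals and Hom-ideals
  coincide.\<close>

lemma simple_hom_lie_zero_twist:
  assumes "simple_hom_lie_algebra scale br (\<lambda>_. 0)"
  shows "simple_anticommutative_algebra scale UNIV br"
proof -
  interpret S: simple_hom_lie_algebra scale br "\<lambda>_. 0" by (fact assms)
  show ?thesis
  proof unfold_locales
    show "\<exists>x\<in>UNIV. \<exists>y\<in>UNIV. br x y \<noteq> 0" using S.not_abelian by simp
    fix K assume "S.ideal K"
    then have "S.hom_ideal K"
      using S.subspace_0 by (auto simp: S.hom_ideal_def S.ideal_def)
    then show "K = {0} \<or> K = UNIV" by (rule S.hom_ideal_trivial)
  qed
qed

text \<open>This makes the two cases exclusive: \<open>\<sigma>\<close> is injective, and the zero
  map is injective only on the zero space, where no bracket is nonzero.\<close>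

lemma cyclic_yau_twist_nonzero:
  assumes "cyclic_yau_twist scale br \<sigma> n lbr S T tbr"
  shows "\<sigma> \<noteq> (\<lambda>_. 0)"
proof
  assume zero: "\<sigma> = (\<lambda>_. 0)"
  have n: "1 \<in> {1..n}" using assms by (simp add: cyclic_yau_twist_def)
  interpret cyclic_lie_automorphism scale lbr \<sigma> n "S 1"
    by (rule cyclic_yau_twist_imp_cyclic_lie_automorphism[OF assms n])
  interpret S: simple_lie_algebra scale "S 1" lbr by (fact component_simple)
  obtain x y where "lbr x y \<noteq> 0" using S.br_nonzero by blast
  moreover have "lbr x y = 0"
    using automorphism_inj unfolding zero by (auto simp: inj_on_def)
  ultimately show False by simp
qed

text \<open>With zero twists, intertwining reduces to \<open>\<phi> 0 = 0\<close>, which additivity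
  gives.\<close>

lemma hom_lie_iso_zero_twist_iff:
  assumes "anticommutative_algebra scaleA UNIV brA" "anticommutative_algebra scaleB UNIV brB"
  shows "hom_lie_iso scaleA brA (\<lambda>_. 0) scaleB brB (\<lambda>_. 0) \<phi> \<longleftrightarrow>
    algebra_iso scaleA UNIV brA scaleB UNIV brB \<phi>"
  using algebra_isomorphism.iso_zero[of scaleA UNIV brA scaleB UNIV brB \<phi>] assms
  by (auto simp: hom_lie_iso_def algebra_isomorphism_def algebra_isomorphism_axioms_def fun_eq_iff)

theorem theorem4p8:
  fixes scaleA :: "'f::field \<Rightarrow> 'a::ab_group_add \<Rightarrow> 'a" and BasisA :: "'a set"
    and scaleB :: "'f \<Rightarrow> 'b::ab_group_add \<Rightarrow> 'b" and BasisB :: "'b set"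
  assumes "finite_dimensional_vector_space scaleA BasisA"
    and "finite_dimensional_vector_space scaleB BasisB"
  shows
    "(\<forall>br \<sigma>. multiplicative_hom_lie_algebra scaleA br \<sigma> \<and> simple_hom_lie_algebra scaleA br \<sigma> \<longrightarrow>
        (let case1 = (\<exists>n lbr S T tbr. cyclic_yau_twist scaleA br \<sigma> n lbr S T tbr);
             case2 = (\<sigma> = (\<lambda>_. 0) \<and> simple_anticommutative_algebra scaleA UNIV br)
         in (case1 \<or> case2) \<and> \<not> (case1 \<and> case2)))
     \<and>
     (\<forall>n brA \<sigma> lbrA S T tbr brB \<eta> lbrB S' T' tbr'.
        cyclic_yau_twist scaleA brA \<sigma> n lbrA S T tbr \<and>
        cyclic_yau_twist scaleB brB \<eta> n lbrB S' T' tbr' \<longrightarrow>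
        ((\<exists>\<Phi>. hom_lie_iso scaleA brA \<sigma> scaleB brB \<eta> \<Phi>) \<longleftrightarrow>
         (\<exists>i\<in>{1..n}. \<exists>j\<in>{1..n}. \<exists>\<phi>. algebra_iso scaleA (S i) lbrA scaleB (S' j) lbrB \<phi> \<and>
            (\<forall>x\<in>S i. (\<sigma> ^^ n) x = inv_into (S i) \<phi> ((\<eta> ^^ n) (\<phi> x))))))
     \<and>
     (\<forall>brA \<sigma> brB \<eta>.
        \<sigma> = (\<lambda>_. 0) \<and> simple_anticommutative_algebra scaleA UNIV brA \<and>
        \<eta> = (\<lambda>_. 0) \<and> simple_anticommutative_algebra scaleB UNIV brB \<longrightarrow>
        ((\<exists>\<Phi>. hom_lie_iso scaleA brA \<sigma> scaleB brB \<eta> \<Phi>) \<longleftrightarrow>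
         (\<exists>\<phi>. algebra_iso scaleA UNIV brA scaleB UNIV brB \<phi>)))"
proof (intro conjI allI impI)
  fix br \<sigma>
  assume A: "multiplicative_hom_lie_algebra scaleA br \<sigma> \<and> simple_hom_lie_algebra scaleA br \<sigma>"
  then have "\<sigma> = (\<lambda>_. 0) \<or> bij \<sigma>"
    using simple_multiplicative_twist_cases[OF assms(1)] by blast
  then have "(\<exists>n lbr S T tbr. cyclic_yau_twist scaleA br \<sigma> n lbr S T tbr) \<or>
      (\<sigma> = (\<lambda>_. 0) \<and> simple_anticommutative_algebra scaleA UNIV br)"
    using simple_hom_lie_bijective_twist[OF assms(1)] simple_hom_lie_zero_twist A by blast
  moreover have "\<not> ((\<exists>n lbr S T tbr. cyclic_yau_twist scaleA br \<sigma> n lbr S T tbr) \<and>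
      (\<sigma> = (\<lambda>_. 0) \<and> simple_anticommutative_algebra scaleA UNIV br))"
    using cyclic_yau_twist_nonzero by blast
  ultimately show "let case1 = (\<exists>n lbr S T tbr. cyclic_yau_twist scaleA br \<sigma> n lbr S T tbr);
        case2 = (\<sigma> = (\<lambda>_. 0) \<and> simple_anticommutative_algebra scaleA UNIV br)
      in (case1 \<or> case2) \<and> \<not> (case1 \<and> case2)"
    unfolding Let_def by (rule conjI)
next
  fix n brA \<sigma> lbrA S T tbr brB \<eta> lbrB S' T' tbr'
  assume "cyclic_yau_twist scaleA brA \<sigma> n lbrA S T tbr \<and>
      cyclic_yau_twist scaleB brB \<eta> n lbrB S' T' tbr'"
  then show "(\<exists>\<Phi>. hom_lie_iso scaleA brA \<sigma> scaleB brB \<eta> \<Phi>) \<longleftrightarrow>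
      (\<exists>i\<in>{1..n}. \<exists>j\<in>{1..n}. \<exists>\<phi>. algebra_iso scaleA (S i) lbrA scaleB (S' j) lbrB \<phi> \<and>
        (\<forall>x\<in>S i. (\<sigma> ^^ n) x = inv_into (S i) \<phi> ((\<eta> ^^ n) (\<phi> x))))"
    by (elim conjE) (rule cyclic_yau_twist_iso_iff)
next
  fix brA :: "'a \<Rightarrow> 'a \<Rightarrow> 'a" and \<sigma> and brB :: "'b \<Rightarrow> 'b \<Rightarrow> 'b" and \<eta>
  assume "\<sigma> = (\<lambda>_::'a. 0::'a) \<and> simple_anticommutative_algebra scaleA UNIV brA \<and>
      \<eta> = (\<lambda>_::'b. 0::'b) \<and> simple_anticommutative_algebra scaleB UNIV brB"
  then show "(\<exists>\<Phi>. hom_lie_iso scaleA brA \<sigma> scaleB brB \<eta> \<Phi>) \<longleftrightarrow>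
      (\<exists>\<phi>. algebra_iso scaleA UNIV brA scaleB UNIV brB \<phi>)"
    using hom_lie_iso_zero_twist_iff[of scaleA brA scaleB brB]
    by (auto simp: simple_anticommutative_algebra_def)
qed

end
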